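(* Let $r\ge 2$ and $k\ge 1$ be integers, let $G$ be an $r$-partite graph with $\mathrm{mad}(G)\le 2k$, and let $t=t(r)$ be the smallest positive integer for which $t^{t+1}\ge r-1$. Then $$\vec{\chi}(G)\le k+3r(t+1)\le k+\frac{3(1+o(1))\,r\log r}{\log\log r},$$ where $o(1)$ denotes a quantity depending only on $r$ that tends to $0$ as $r\to\infty$ (the second inequality being understood asymptotically as $r\to\infty$).
   Context: All graphs are finite and simple; $\log$ is the natural logarithm. An orientation of $G$ chooses a direction for each edge; $d^+(v)$ is the number of edges directed out of $v$. An orientation is proper if $d^+(u)\neq d^+(v)$ for every edge $uv$. The proper orientation number $\vec{\chi}(G)$ is the minimum, over all proper orientations of $G$, of $\max_{v\in V(G)} d^+(v)$ (every graph has a proper orientation). The maximum average degree is $\mathrm{mad}(G)=\max_{H\subseteq G} \frac{2|E(H)|}{|V(H)|}$, the maximum over all subgraphs $H$ of $G$ with at least one vertex. A graph is $r$-partite if its vertex set can be partitioned into $r$ independent sets. *)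

theory Defs
  imports Complex_Main "HOL-Library.Disjoint_Sets"
begin

record 'a ugraph =
  verts :: "'a set"
  edges :: "'a set set"

definition simple_graph :: "'a ugraph \<Rightarrow> bool" where
  "simple_graph G \<longleftrightarrow> finite (verts G) \<and> (\<forall>e\<in>edges G. e \<subseteq> verts G \<and> card e = 2)"

definition is_subgraph :: "'a ugraph \<Rightarrow> 'a ugraph \<Rightarrow> bool" where
  "is_subgraph H G \<longleftrightarrow> simple_graph H \<and> verts H \<subseteq> verts G \<and> edges H \<subseteq> edges G"

text \<open>The inserted 0 matters only for the graph without vertices: every average degree
  is nonnegative.\<close>

definition mad :: "'a ugraph \<Rightarrow> real" where
  "mad G = Max (insert 0 {2 * real (card (edges H)) / real (card (verts H)) | H.
                            is_subgraph H G \<and> verts H \<noteq> {}})"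

definition independent :: "'a ugraph \<Rightarrow> 'a set \<Rightarrow> bool" where
  "independent G S \<longleftrightarrow> S \<subseteq> verts G \<and> (\<forall>u\<in>S. \<forall>v\<in>S. {u, v} \<notin> edges G)"

text \<open>The classes may be empty, so an \<open>r\<close>-partite graph is also \<open>(r + 1)\<close>-partite.\<close>

definition partite :: "nat \<Rightarrow> 'a ugraph \<Rightarrow> bool" where
  "partite r G \<longleftrightarrow> (\<exists>P :: nat \<Rightarrow> 'a set. disjoint_family_on P {..<r} \<and>
     (\<Union>i<r. P i) = verts G \<and> (\<forall>i<r. independent G (P i)))"

text \<open>An orientation is given by its set of arcs; \<open>(u, v)\<close> is directed out of \<open>u\<close>.\<close>

definition orientation :: "'a ugraph \<Rightarrow> ('a \<times> 'a) set \<Rightarrow> bool" where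
  "orientation G D \<longleftrightarrow> (\<forall>(u, v)\<in>D. {u, v} \<in> edges G) \<and>
     (\<forall>u v. {u, v} \<in> edges G \<longrightarrow> ((u, v) \<in> D \<longleftrightarrow> (v, u) \<notin> D))"

definition outdeg :: "('a \<times> 'a) set \<Rightarrow> 'a \<Rightarrow> nat" where
  "outdeg D v = card {w. (v, w) \<in> D}"

definition proper_orientation :: "'a ugraph \<Rightarrow> ('a \<times> 'a) set \<Rightarrow> bool" where
  "proper_orientation G D \<longleftrightarrow> orientation G D \<and>
     (\<forall>u v. {u, v} \<in> edges G \<longrightarrow> outdeg D u \<noteq> outdeg D v)"

text \<open>Again, the inserted 0 matters only for the graph without vertices.\<close>

definition max_outdeg :: "'a ugraph \<Rightarrow> ('a \<times> 'a) set \<Rightarrow> nat" where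
  "max_outdeg G D = Max (insert 0 (outdeg D ` verts G))"

definition proper_orientation_number :: "'a ugraph \<Rightarrow> nat" where
  "proper_orientation_number G =
     (LEAST m. \<exists>D. proper_orientation G D \<and> max_outdeg G D = m)"

definition t_of :: "nat \<Rightarrow> nat" where
  "t_of r = (LEAST t. t \<ge> 1 \<and> t ^ (t + 1) \<ge> r - 1)"

end

theory Submission
  imports Defs "HOL-Real_Asymp.Real_Asymp" "HOL-Analysis.Complex_Transcendental"
begin

text \<open>  Put \<open>T = k + 3 r (t + 1)\<close>.  The final outdegrees are handed out in decreasing order: at the
  levels \<open>X = T, T - 1, \<dots>, 0\<close> an independent set \<open>S\<close> of undecided vertices is chosen, and
  its members are decided, with outdegree \<open>X\<close>.  Vertices decided at the same level are not
  adjacent and different levels give different outdegrees, so the orientation is proper with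
  outdegrees at most \<open>T\<close>, provided that every vertex gets decided.

  In between, edges may be oriented fractionally: \<open>u\<close> pays a share \<open>x u v\<close> of the edge \<open>u v\<close>
  and \<open>v\<close> pays the rest.  Undecided vertices pay at most \<open>k\<close> in total; an orientation with
  this property exists because of the bound on the maximum average degree, by Hall's theorem
  (\<open>initial_state\<close>).  The quantity to watch is the potential \<open>pot v\<close> of an undecided vertex, that
  is, its payments to decided vertices plus the number of its undecided neighbours; it is
  the most that \<open>v\<close> can still come to pay.  A vertex that pays at most \<open>X\<close> and has \<open>pot v \<ge> X\<close>
  can be decided at level \<open>X\<close>, by taking over a suitable part of the edges to its
  undecided neighbours.  This is a gain for those neighbours: their potentials drop by what they no longer can be asked
  to pay.  If the potentials follow the level down to \<open>0\<close>, every vertex has been decided.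

  \<^item> Potentials far above the level.  At each level, \<open>S\<close> is a maximal independent set among
    the vertices with \<open>pot v \<ge> X\<close> that contains those of one colour class, and each of its
    members takes a fixed fraction of every edge share open to it.  Every other vertex with
    \<open>pot v \<ge> X\<close> has a neighbour in \<open>S\<close>, hence loses at least the fraction of this one, which is close to \<open>1\<close> when the excess
    \<open>pot v - X\<close> is small compared with \<open>X - k\<close> (\<open>fractional_level\<close>).  After a phase of \<open>r\<close> levels, one
    for each colour class, every undecided vertex has been below the level once, and its
    excess is what it has drifted upwards since then (\<open>phase\<close>).  The first phase leaves an excess of
    at most \<open>r\<close>.  Since \<open>X - k \<ge> 2 r (t + 1)\<close> in the next \<open>t\<close> phases, each of them turns an excess \<open>B\<close>
    into one of at most \<open>1 + B / (2 t + 1)\<close> (\<open>phases\<close>).  In the end the excess is at most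
    \<open>r / (2 t + 1) ^ t + 1 + 1 / (2 t)\<close>, and \<open>t ^ (t + 1) \<ge> r - 1\<close> makes this at most \<open>2\<close> if \<open>t \<ge> 2\<close>.
    If \<open>t = 1\<close> then \<open>r = 2\<close>, and the first phase suffices.

  \<^item> Excess at most \<open>2\<close>.  The orientation is rounded to an integral one (\<open>integralise\<close>), and a
    further \<open>r\<close> levels remove the excess (\<open>sweep\<close>): \<open>S\<close> is now an independent set of maximum
    weight, where the vertices of the current colour class weigh as much as they have to lose.
    An exchange argument shows that every other vertex with \<open>pot v \<ge> X\<close> has enough neighbours in \<open>S\<close>, even though
    a member of \<open>S\<close> with potential \<open>X + 1\<close> or \<open>X + 2\<close> has to leave one or two edges to its
    neighbours.

  \<^item> No excess.  From then on, the members of a maximal independent set of the vertices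
    with \<open>pot v = X\<close> take all edges open to them, which keeps the orientation integral and all
    potentials at most the next level (\<open>greedy_levels\<close>).

  The asymptotic form follows from the minimality of \<open>t\<close>: for \<open>t \<ge> 2\<close> it gives \<open>(t - 1) ^ t < r - 1\<close>, so
  \<open>t ln (t - 1) \<le> ln r\<close>, and therefore \<open>t\<close> is at most \<open>(1 + o(1)) ln r / ln (ln r)\<close>.
\<close>

section \<open>Assignments with prescribed loads\<close>

text \<open>Hall's theorem for assigning items to bins, where bin \<open>v\<close> takes up to \<open>cap v\<close> items.  As long as
  some item has two candidate bins, one of them can be struck off without destroying the
  condition: two violating sets, one for each of the two bins, would contradict the
  condition for their union and their intersection, because \<open>sum cap\<close> is modular.\<close>

lemma hall_with_capacities:
  fixes N :: "'i \<Rightarrow> 'v set" and cap :: "'v \<Rightarrow> nat"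
  assumes "finite I" "\<And>i. i \<in> I \<Longrightarrow> finite (N i)"
    and "\<And>J. J \<subseteq> I \<Longrightarrow> card J \<le> sum cap (\<Union>(N ` J))"
  shows "\<exists>\<phi>. (\<forall>i\<in>I. \<phi> i \<in> N i) \<and> (\<forall>v. card {i\<in>I. \<phi> i = v} \<le> cap v)"
  using assms(2,3)
proof (induction "\<Sum>i\<in>I. card (N i)" arbitrary: N rule: less_induct)
  case less
  note finN = less.prems(1) and hall = less.prems(2)
  show ?case
  proof (cases "\<exists>i\<in>I. \<exists>a\<in>N i. \<exists>b\<in>N i. a \<noteq> b")
    case False
    have ne: "N i \<noteq> {}" if "i \<in> I" for i
      using hall[of "{i}"] that by auto
    define \<phi> where "\<phi> i = (SOME v. v \<in> N i)" for i
    have mem: "\<phi> i \<in> N i" if "i \<in> I" for i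
      using ne[OF that] unfolding \<phi>_def by (simp add: some_in_eq)
    have "card {i\<in>I. \<phi> i = v} \<le> cap v" for v
    proof -
      have "card {i\<in>I. \<phi> i = v} \<le> sum cap (\<Union>(N ` {i\<in>I. \<phi> i = v}))"
        by (rule hall) auto
      also have "\<dots> \<le> sum cap {v}"
        using False mem by (intro sum_mono2) auto
      finally show ?thesis by simp
    qed
    with mem show ?thesis by blast
  next
    case True
    then obtain i a b where i: "i \<in> I" "a \<in> N i" "b \<in> N i" "a \<noteq> b" by blast
    have delete_candidate: ?thesis if z: "z \<in> N i"
      and ok: "\<And>J. J \<subseteq> I \<Longrightarrow> card J \<le> sum cap (\<Union>((N(i := N i - {z})) ` J))" for z
    proof -
      let ?N = "N(i := N i - {z})"
      have "(\<Sum>j\<in>I. card (?N j)) < (\<Sum>j\<in>I. card (N j))"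
      proof (rule sum_strict_mono_ex1)
        show "\<forall>j\<in>I. card (?N j) \<le> card (N j)"
          by (simp add: card_Diff1_le)
        show "\<exists>j\<in>I. card (?N j) < card (N j)"
        proof (rule bexI[OF _ i(1)])
          show "card (?N i) < card (N i)"
            unfolding fun_upd_same by (rule card_Diff1_less[OF finN[OF i(1)] z])
        qed
      qed (fact \<open>finite I\<close>)
      then have "\<exists>\<phi>. (\<forall>j\<in>I. \<phi> j \<in> ?N j) \<and> (\<forall>v. card {j\<in>I. \<phi> j = v} \<le> cap v)"
        by (rule less.hyps) (use finN ok in auto)
      then obtain \<phi> where \<phi>: "\<And>j. j \<in> I \<Longrightarrow> \<phi> j \<in> ?N j" "\<forall>v. card {j\<in>I. \<phi> j = v} \<le> cap v"
        by blast
      have "\<phi> j \<in> N j" if "j \<in> I" for j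
        using \<phi>(1)[OF that] by (simp split: if_splits)
      with \<phi>(2) show ?thesis by blast
    qed
    have violated: "\<exists>J\<subseteq>I - {i}. sum cap (\<Union>(N ` J) \<union> (N i - {z})) \<le> card J"
      if "\<not> (\<forall>J\<subseteq>I. card J \<le> sum cap (\<Union>((N(i := N i - {z})) ` J)))" for z
    proof -
      from that obtain J where J: "J \<subseteq> I" "card J > sum cap (\<Union>((N(i := N i - {z})) ` J))"
        by (auto simp: not_le)
      have "i \<in> J"
      proof (rule ccontr)
        assume "i \<notin> J"
        then have "\<Union>((N(i := N i - {z})) ` J) = \<Union>(N ` J)" by auto
        with J hall[of J] show False by simp
      qed
      have eq: "\<Union>((N(i := N i - {z})) ` J) = \<Union>(N ` (J - {i})) \<union> (N i - {z})"
        using \<open>i \<in> J\<close> by auto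
      have "finite J" using J(1) \<open>finite I\<close> finite_subset by blast
      then have "card J = Suc (card (J - {i}))"
        using \<open>i \<in> J\<close> by (metis card.remove)
      then show ?thesis
        using J eq by (intro exI[of _ "J - {i}"]) auto
    qed
    show ?thesis
    proof (rule ccontr)
      assume no: "\<not> ?thesis"
      have *: "\<exists>J\<subseteq>I - {i}. sum cap (\<Union>(N ` J) \<union> (N i - {z})) \<le> card J" if "z \<in> N i" for z
      proof (rule violated[OF notI])
        assume ok: "\<forall>J\<subseteq>I. card J \<le> sum cap (\<Union>((N(i := N i - {z})) ` J))"
        have "\<exists>\<phi>. (\<forall>j\<in>I. \<phi> j \<in> N j) \<and> (\<forall>v. card {j\<in>I. \<phi> j = v} \<le> cap v)"
          by (rule delete_candidate[OF that]) (rule ok[rule_format])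
        with no show False by contradiction
      qed
      obtain J1 where J1: "J1 \<subseteq> I - {i}" "sum cap (\<Union>(N ` J1) \<union> (N i - {a})) \<le> card J1"
        using *[OF i(2)] by blast
      obtain J2 where J2: "J2 \<subseteq> I - {i}" "sum cap (\<Union>(N ` J2) \<union> (N i - {b})) \<le> card J2"
        using *[OF i(3)] by blast
      define A where "A = \<Union>(N ` J1) \<union> (N i - {a})"
      define B where "B = \<Union>(N ` J2) \<union> (N i - {b})"
      have fJ: "finite J1" "finite J2" using J1 J2 \<open>finite I\<close> finite_subset by blast+
      have fin: "finite A" "finite B"
        unfolding A_def B_def using J1 J2 fJ finN i by (auto intro!: finite_UN_I)
      have "Suc (card (J1 \<union> J2)) = card (insert i (J1 \<union> J2))"
        using J1 J2 fJ by (subst card_insert_disjoint) auto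
      also have "\<dots> \<le> sum cap (\<Union>(N ` insert i (J1 \<union> J2)))"
        using J1 J2 i by (intro hall) auto
      also have "\<Union>(N ` insert i (J1 \<union> J2)) = A \<union> B"
        unfolding A_def B_def using i by auto
      finally have 1: "Suc (card (J1 \<union> J2)) \<le> sum cap (A \<union> B)" .
      have "card (J1 \<inter> J2) \<le> sum cap (\<Union>(N ` (J1 \<inter> J2)))"
        using J1 by (intro hall) auto
      also have "\<dots> \<le> sum cap (A \<inter> B)"
        using fin unfolding A_def B_def by (intro sum_mono2) auto
      finally have 2: "card (J1 \<inter> J2) \<le> sum cap (A \<inter> B)" .
      have "sum cap (A \<union> B) + sum cap (A \<inter> B) = sum cap A + sum cap B"
        using fin by (rule sum.union_inter)
      moreover have "card (J1 \<union> J2) + card (J1 \<inter> J2) = card J1 + card J2"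
        using card_Un_Int[OF fJ] by simp
      ultimately show False
        using 1 2 J1(2) J2(2) unfolding A_def[symmetric] B_def[symmetric] by linarith
    qed
  qed
qed

text \<open>A fractional assignment of items to bins can be rounded to an integral one that respects
  the same integral load bounds, and attains them on \<open>A\<close>.  Dummy items that may go to every bin
  outside \<open>A\<close> use up the remaining capacity, so that in a Hall assignment all bins are
  full; no bin of \<open>A\<close> can then be short of an item.\<close>

lemma integral_assignment:
  fixes N :: "'i \<Rightarrow> 'v set" and g :: "'i \<Rightarrow> 'v \<Rightarrow> real" and cap :: "'v \<Rightarrow> nat"
  assumes finI: "finite I" and finV: "finite V" and NV: "\<And>i. i \<in> I \<Longrightarrow> N i \<subseteq> V"
    and nonneg: "\<And>i v. i \<in> I \<Longrightarrow> v \<in> N i \<Longrightarrow> 0 \<le> g i v"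
    and total: "\<And>i. i \<in> I \<Longrightarrow> (\<Sum>v\<in>N i. g i v) = 1"
    and load: "\<And>v. v \<in> V \<Longrightarrow> (\<Sum>i | i \<in> I \<and> v \<in> N i. g i v) \<le> real (cap v)"
    and AV: "A \<subseteq> V"
    and exact: "\<And>v. v \<in> A \<Longrightarrow> (\<Sum>i | i \<in> I \<and> v \<in> N i. g i v) = real (cap v)"
  shows "\<exists>\<phi>. (\<forall>i\<in>I. \<phi> i \<in> N i) \<and> (\<forall>v\<in>V. card {i\<in>I. \<phi> i = v} \<le> cap v)
    \<and> (\<forall>v\<in>A. card {i\<in>I. \<phi> i = v} = cap v)"
proof -
  have finN: "finite (N i)" if "i \<in> I" for i
    using NV[OF that] finV finite_subset by blast
  define G where "G i v = (if i \<in> I \<and> v \<in> N i then g i v else 0)" for i v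
  have G0: "0 \<le> G i v" for i v unfolding G_def using nonneg by auto
  have Gtotal: "(\<Sum>v\<in>V. G i v) = 1" if "i \<in> I" for i
  proof -
    have "(\<Sum>v\<in>V. G i v) = (\<Sum>v\<in>N i. G i v)"
      using NV[OF that] finV by (intro sum.mono_neutral_right) (auto simp: G_def)
    also have "\<dots> = 1" using total[OF that] that by (simp add: G_def)
    finally show ?thesis .
  qed
  have Gload: "(\<Sum>i\<in>I. G i v) = (\<Sum>i | i \<in> I \<and> v \<in> N i. g i v)" for v
  proof -
    have "(\<Sum>i\<in>I. G i v) = (\<Sum>i | i \<in> I \<and> v \<in> N i. G i v)"
      using finI by (intro sum.mono_neutral_right) (auto simp: G_def)
    also have "\<dots> = (\<Sum>i | i \<in> I \<and> v \<in> N i. g i v)"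
      by (intro sum.cong) (auto simp: G_def)
    finally show ?thesis .
  qed
  have count: "real (card J) = (\<Sum>v\<in>V. \<Sum>i\<in>J. G i v)" if "J \<subseteq> I" for J
  proof -
    have "(\<Sum>v\<in>V. \<Sum>i\<in>J. G i v) = (\<Sum>i\<in>J. \<Sum>v\<in>V. G i v)" by (rule sum.swap)
    also have "\<dots> = (\<Sum>i\<in>J. 1)" using that Gtotal by (intro sum.cong) auto
    finally show ?thesis by simp
  qed
  have part: "(\<Sum>i\<in>J. G i v) \<le> real (cap v)" if "J \<subseteq> I" "v \<in> V" for J v
    using load[OF that(2)] sum_mono2[OF finI that(1), of "\<lambda>i. G i v"] G0 unfolding Gload by force
  have size: "card I \<le> sum cap V"
  proof -
    have "real (card I) \<le> (\<Sum>v\<in>V. real (cap v))"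
      unfolding count[OF subset_refl] by (intro sum_mono part) auto
    then show ?thesis by (simp flip: of_nat_sum)
  qed
  \<comment> \<open>\<open>D\<close> is the capacity that the items leave unused, hence the number of dummy items.\<close>
  define D where "D = sum cap V - card I"
  define I' where "I' = Inl ` I \<union> Inr ` {..<D}"
  define N' where "N' = case_sum N (\<lambda>_::nat. V - A)"
  have finI': "finite I'" unfolding I'_def using finI by auto
  have cardI': "card I' = sum cap V"
    unfolding I'_def using finI size by (subst card_Un_disjoint) (auto simp: card_image D_def)
  have "\<exists>\<psi>. (\<forall>i\<in>I'. \<psi> i \<in> N' i) \<and> (\<forall>v. card {i\<in>I'. \<psi> i = v} \<le> cap v)"
  proof (rule hall_with_capacities)
    show "finite I'" by fact
    show "finite (N' i)" if "i \<in> I'" for i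
      using that finN finV unfolding I'_def N'_def by auto
    show "card J \<le> sum cap (\<Union> (N' ` J))" if J: "J \<subseteq> I'" for J
    proof -
      define J1 where "J1 = Inl -` J"
      have J1: "J1 \<subseteq> I" using J unfolding J1_def I'_def by auto
      have finJ: "finite J" using J finI' finite_subset by blast
      have UJ: "\<Union> (N' ` J) \<subseteq> V" using J NV unfolding I'_def N'_def by fastforce
      have NJ1: "\<Union>(N ` J1) \<subseteq> \<Union> (N' ` J)" unfolding J1_def N'_def by force
      show ?thesis
      proof (cases "J \<subseteq> Inl ` I")
        case True
        then have eqJ: "J = Inl ` J1" unfolding J1_def by auto
        then have "card J = card J1" by (simp add: card_image)
        also have "real (card J1) = (\<Sum>v\<in>V. \<Sum>i\<in>J1. G i v)" by (rule count[OF J1])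
        also have "\<dots> = (\<Sum>v\<in>\<Union> (N' ` J). \<Sum>i\<in>J1. G i v)"
        proof (intro sum.mono_neutral_right ballI finV UJ)
          fix v assume "v \<in> V - \<Union> (N' ` J)"
          then have "G i v = 0" if "i \<in> J1" for i
            using NJ1 that unfolding G_def by auto
          then show "(\<Sum>i\<in>J1. G i v) = 0" by simp
        qed
        also have "\<dots> \<le> (\<Sum>v\<in>\<Union> (N' ` J). real (cap v))"
          using UJ by (intro sum_mono part J1) auto
        finally show ?thesis by (simp flip: of_nat_sum)
      next
        case False
        then obtain y where "y \<in> J" "y \<notin> Inl ` I" by blast
        then have "y \<in> Inr ` {..<D}" using J unfolding I'_def by blast
        then obtain d where "Inr d \<in> J" using \<open>y \<in> J\<close> by (elim imageE) simp
        then have VA: "V - A \<subseteq> \<Union> (N' ` J)" unfolding N'_def by force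
        \<comment> \<open>With a dummy item in \<open>J\<close>, only bins of \<open>A\<close> are missing from the neighbourhood; their capacity is used up by items outside \<open>J\<close>.\<close>
        define Z where "Z = V - \<Union> (N' ` J)"
        have ZA: "Z \<subseteq> A" "Z \<subseteq> V" using VA unfolding Z_def by auto
        have "real (sum cap Z) = (\<Sum>v\<in>Z. \<Sum>i\<in>I. G i v)"
          using exact ZA by (auto simp: Gload intro!: sum.cong)
        also have "\<dots> = (\<Sum>v\<in>Z. \<Sum>i\<in>I - J1. G i v)"
        proof (rule sum.cong[OF refl])
          fix v assume "v \<in> Z"
          then have "G i v = 0" if "i \<in> J1" for i
            using NJ1 that unfolding G_def Z_def by auto
          then show "(\<Sum>i\<in>I. G i v) = (\<Sum>i\<in>I - J1. G i v)"
            by (intro sum.mono_neutral_right finI) auto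
        qed
        also have "\<dots> \<le> (\<Sum>v\<in>V. \<Sum>i\<in>I - J1. G i v)"
          using ZA finV G0 by (intro sum_mono2) (auto intro: sum_nonneg)
        also have "\<dots> = real (card (I - J1))" by (rule count[symmetric]) auto
        finally have Z: "sum cap Z \<le> card (I - J1)" by (simp only: of_nat_le_iff)
        have "card J \<le> card (Inl ` J1 \<union> (Inr ` {..<D} :: ('i + nat) set))"
        proof (rule card_mono)
          show "finite (Inl ` J1 \<union> (Inr ` {..<D} :: ('i + nat) set))"
            using finite_subset[OF J1 finI] by simp
          show "J \<subseteq> Inl ` J1 \<union> Inr ` {..<D}"
            using J unfolding J1_def I'_def by auto
        qed
        also have "\<dots> \<le> card (Inl ` J1 :: ('i + nat) set) + card (Inr ` {..<D} :: ('i + nat) set)" by (rule card_Un_le)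
        also have "\<dots> = card J1 + D" by (simp add: card_image)
        finally have "card J \<le> card J1 + D" .
        moreover have "card (I - J1) = card I - card J1" "card J1 \<le> card I"
          using J1 finI by (auto simp: card_Diff_subset finite_subset card_mono)
        moreover have "sum cap V = sum cap (\<Union> (N' ` J)) + sum cap Z"
          unfolding Z_def using UJ finV by (simp add: sum.subset_diff add.commute)
        ultimately show ?thesis using Z size unfolding D_def by linarith
      qed
    qed
  qed
  then obtain \<psi> where \<psi>: "\<And>i. i \<in> I' \<Longrightarrow> \<psi> i \<in> N' i" "\<And>v. card {i\<in>I'. \<psi> i = v} \<le> cap v" by blast
  have N'V: "N' i \<subseteq> V" if "i \<in> I'" for i
    using that NV unfolding I'_def N'_def by (elim UnE imageE; simp)
  then have \<psi>V: "\<psi> i \<in> V" if "i \<in> I'" for i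
    using \<psi>(1)[OF that] that by blast
  have "card I' = (\<Sum>v\<in>V. card {i\<in>I'. \<psi> i = v})"
    using sum.group[OF finI' finV, of \<psi> "\<lambda>_. 1 :: nat"] \<psi>V by (simp add: image_subset_iff)
  then have sat: "card {i\<in>I'. \<psi> i = v} = cap v" if "v \<in> V" for v
    using cardI' sum_mono_inv[of "\<lambda>v. card {i\<in>I'. \<psi> i = v}" V cap v] \<psi>(2) finV that by simp
  have inj: "card {i\<in>I. \<psi> (Inl i) = v} = card (Inl ` {i\<in>I. \<psi> (Inl i) = v} :: ('i + nat) set)" for v
    by (simp add: card_image)
  show ?thesis
  proof (intro exI[of _ "\<lambda>i. \<psi> (Inl i)"] conjI ballI)
    show "\<psi> (Inl i) \<in> N i" if "i \<in> I" for i
      using \<psi>(1)[of "Inl i"] that unfolding I'_def N'_def by auto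
    show "card {i\<in>I. \<psi> (Inl i) = v} \<le> cap v" if "v \<in> V" for v
      unfolding inj sat[OF that, symmetric]
      using finI' by (intro card_mono) (auto simp: I'_def)
    show "card {i\<in>I. \<psi> (Inl i) = v} = cap v" if "v \<in> A" for v
    proof -
      have "{i\<in>I'. \<psi> i = v} = Inl ` {i\<in>I. \<psi> (Inl i) = v}"
        using \<psi>(1) that unfolding I'_def N'_def by fastforce
      then show ?thesis using sat[of v] that AV inj[of v] by auto
    qed
  qed
qed

section \<open>Fractional orientations with decided vertices\<close>

text \<open>The number \<open>k\<close> only enters as the bound on what an undecided vertex pays.\<close>

locale coloured_graph =
  fixes V :: "'a set" and E :: "'a \<Rightarrow> 'a \<Rightarrow> bool" and c :: "'a \<Rightarrow> nat" and r k :: nat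
  assumes finV: "finite V"
    and E_V: "E u v \<Longrightarrow> u \<in> V \<and> v \<in> V"
    and E_sym: "E u v \<Longrightarrow> E v u"
    and c_E: "E u v \<Longrightarrow> c u \<noteq> c v"
    and c_less: "v \<in> V \<Longrightarrow> c v < r"
begin

lemma finite_sub: "U \<subseteq> V \<Longrightarrow> finite U"
  using finV by (rule rev_finite_subset)

lemma E_irrefl [simp]: "\<not> E v v"
  using c_E by blast

lemma E_commute: "E u v \<longleftrightarrow> E v u"
  using E_sym by blast

text \<open>\<open>x u v\<close> is the share of the edge \<open>u v\<close> that is paid by \<open>u\<close>.  If all shares are integers, \<open>x\<close> is an
  orientation, where the tail of an arc pays for it.\<close>

definition fractional :: "('a \<Rightarrow> 'a \<Rightarrow> real) \<Rightarrow> bool" where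
  "fractional x \<longleftrightarrow> (\<forall>u v. 0 \<le> x u v \<and> x u v + x v u = (if E u v then 1 else 0))"

definition outw :: "('a \<Rightarrow> 'a \<Rightarrow> real) \<Rightarrow> 'a \<Rightarrow> real" where
  "outw x v = (\<Sum>u\<in>V. x v u)"

text \<open>What \<open>v\<close> pays if, in addition to its present payments to the vertices outside \<open>U\<close>, it pays in
  full for its edges to \<open>U\<close>.\<close>

definition pot :: "('a \<Rightarrow> 'a \<Rightarrow> real) \<Rightarrow> 'a set \<Rightarrow> 'a \<Rightarrow> real" where
  "pot x U v = (\<Sum>u\<in>V - U. x v u) + real (card {u\<in>U. E v u})"

text \<open>The situation when the levels \<open>T, T - 1, \<dots>, X\<close> have been dealt with: \<open>U\<close> is the set of undecided
  vertices, and \<open>h\<close> gives the outdegrees of the others.  Edges inside \<open>U\<close> stay integral, since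
  only edges at decided vertices are ever changed; this is what allows rounding without
  exceeding the bound \<open>k\<close>.\<close>

definition state :: "nat \<Rightarrow> nat \<Rightarrow> ('a \<Rightarrow> 'a \<Rightarrow> real) \<Rightarrow> 'a set \<Rightarrow> ('a \<Rightarrow> nat) \<Rightarrow> bool" where
  "state X T x U h \<longleftrightarrow> fractional x \<and> U \<subseteq> V \<and> (\<forall>u\<in>U. outw x u \<le> real k)
     \<and> (\<forall>v\<in>V - U. outw x v = real (h v) \<and> X \<le> h v \<and> h v \<le> T)
     \<and> (\<forall>u\<in>V - U. \<forall>v\<in>V - U. E u v \<longrightarrow> h u \<noteq> h v)
     \<and> (\<forall>u\<in>U. \<forall>v\<in>U. x u v \<in> \<int>)"

definition indep :: "'a set \<Rightarrow> bool" where
  "indep S \<longleftrightarrow> (\<forall>u\<in>S. \<forall>v\<in>S. \<not> E u v)"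

lemma frac_nonneg: "fractional x \<Longrightarrow> 0 \<le> x u v"
  by (simp add: fractional_def)

lemma frac_edge: "fractional x \<Longrightarrow> E u v \<Longrightarrow> x u v + x v u = 1"
  by (simp add: fractional_def)

lemma frac_nonedge:
  assumes "fractional x" "\<not> E u v"
  shows "x u v = 0"
proof -
  have "x u v + x v u = 0" using assms by (simp add: fractional_def)
  then show ?thesis using frac_nonneg[OF assms(1), of u v] frac_nonneg[OF assms(1), of v u] by linarith
qed

lemma frac_le_1: "fractional x \<Longrightarrow> x u v \<le> 1"
  using frac_nonneg[of x v u] frac_edge[of x u v] frac_nonedge[of x u v] by (cases "E u v") auto

lemma sum_indicator_E: "finite A \<Longrightarrow> (\<Sum>u\<in>A. (if E v u then 1 else 0 :: real)) = real (card {u\<in>A. E v u})"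
  by (simp add: sum.If_cases Int_def)

lemma pot_minus_out:
  assumes "fractional x" "U \<subseteq> V"
  shows "pot x U v - outw x v = (\<Sum>u\<in>U. x u v)"
proof -
  have finU: "finite U" by (rule finite_sub[OF assms(2)])
  have "outw x v = (\<Sum>u\<in>V - U. x v u) + (\<Sum>u\<in>U. x v u)"
    unfolding outw_def using sum.subset_diff[OF assms(2) finV] by simp
  moreover have "real (card {u\<in>U. E v u}) = (\<Sum>u\<in>U. x v u + x u v)"
    unfolding sum_indicator_E[OF finU, symmetric]
    using assms(1) by (intro sum.cong) (auto simp: fractional_def)
  ultimately show ?thesis unfolding pot_def by (simp add: sum.distrib)
qed

lemma outw_le_pot: "fractional x \<Longrightarrow> U \<subseteq> V \<Longrightarrow> outw x v \<le> pot x U v"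
  using pot_minus_out[of x U v] sum_nonneg[of U "\<lambda>u. x u v"] frac_nonneg by force

lemma int_01:
  assumes "fractional x" "\<And>u v. x u v \<in> \<int>"
  shows "x u v = 0 \<or> x u v = 1"
proof -
  obtain n where "x u v = of_int n" using assms(2)[of u v] by (elim Ints_cases)
  then show ?thesis using frac_nonneg[OF assms(1), of u v] frac_le_1[OF assms(1), of u v] by auto
qed

lemma pot_outw_Ints:
  assumes "fractional x" "\<And>u v. x u v \<in> \<int>"
  shows "pot x U v \<in> \<int>" "outw x v \<in> \<int>"
  unfolding pot_def outw_def using assms(2) by auto

section \<open>Deciding an independent set\<close>

text \<open>The bookkeeping common to all kinds of levels: an independent set \<open>S\<close> is decided with the
  value \<open>X\<close>, by moving payments from \<open>U - S\<close> to \<open>S\<close>.  A vertex \<open>u\<close> that stays undecided can no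
  longer be asked for the payments \<open>x' s u\<close> of its neighbours in \<open>S\<close>.\<close>

lemma state_peel:
  assumes st: "state (Suc X) T x U h" and XT: "X \<le> T"
    and SU: "S \<subseteq> U" and indS: "indep S" and fx': "fractional x'"
    and agree: "\<And>u v. \<not> (u \<in> S \<and> v \<in> U - S) \<Longrightarrow> \<not> (v \<in> S \<and> u \<in> U - S) \<Longrightarrow> x' u v = x u v"
    and outS: "\<And>s. s \<in> S \<Longrightarrow> outw x' s = real X"
    and less: "\<And>u. u \<in> U - S \<Longrightarrow> (\<Sum>s\<in>S. x' u s) \<le> (\<Sum>s\<in>S. x u s)"
  shows "state X T x' (U - S) (\<lambda>v. if v \<in> S then X else h v)"
    and "\<And>u. u \<in> U - S \<Longrightarrow> pot x' (U - S) u = pot x U u - (\<Sum>s\<in>S. x' s u)"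
proof -
  have UV: "U \<subseteq> V" and fx: "fractional x" using st unfolding state_def by auto
  have finU: "finite U" and finS: "finite S"
    using finite_sub[OF UV] finite_sub[OF subset_trans[OF SU UV]] by auto
  have out_other: "outw x' v = outw x v" if "v \<in> V - U" for v
    unfolding outw_def using that SU by (intro sum.cong refl agree) auto
  have out_U: "outw x' u \<le> outw x u" if "u \<in> U - S" for u
  proof -
    have SV: "S \<subseteq> V" using SU UV by blast
    have "(\<Sum>v\<in>V - S. x' u v) = (\<Sum>v\<in>V - S. x u v)"
      using that by (intro sum.cong refl agree) auto
    then show ?thesis
      unfolding outw_def sum.subset_diff[OF SV finV] using less[OF that] by simp
  qed
  show "state X T x' (U - S) (\<lambda>v. if v \<in> S then X else h v)"
    unfolding state_def
  proof (intro conjI ballI impI)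
    show "fractional x'" by fact
    show "U - S \<subseteq> V" using UV by blast
    show "outw x' u \<le> real k" if "u \<in> U - S" for u
      using out_U[OF that] st that unfolding state_def by force
    fix v assume v: "v \<in> V - (U - S)"
    show "outw x' v = real (if v \<in> S then X else h v)"
      using v outS out_other[of v] st unfolding state_def by auto
    show "X \<le> (if v \<in> S then X else h v)" "(if v \<in> S then X else h v) \<le> T"
      using v st XT unfolding state_def by (auto dest: bspec[of _ _ v])
    fix u assume u: "u \<in> V - (U - S)" and uv: "E u v"
    show "(if u \<in> S then X else h u) \<noteq> (if v \<in> S then X else h v)"
      using u v uv st indS unfolding state_def indep_def
      by (auto dest: bspec[of _ _ u] bspec[of _ _ v])
  next
    fix u v assume "u \<in> U - S" "v \<in> U - S"
    then show "x' u v \<in> \<int>"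
      using st agree[of u v] unfolding state_def by auto
  qed
  show "pot x' (U - S) u = pot x U u - (\<Sum>s\<in>S. x' s u)" if u: "u \<in> U - S" for u
  proof -
    have V': "V - (U - S) = (V - U) \<union> S" using SU UV by blast
    have "(\<Sum>v\<in>V - (U - S). x' u v) = (\<Sum>v\<in>V - U. x' u v) + (\<Sum>v\<in>S. x' u v)"
      unfolding V' using SU finS finV by (intro sum.union_disjoint) auto
    also have "(\<Sum>v\<in>V - U. x' u v) = (\<Sum>v\<in>V - U. x u v)"
      using u SU by (intro sum.cong refl agree) auto
    finally have 1: "(\<Sum>v\<in>V - (U - S). x' u v) = (\<Sum>v\<in>V - U. x u v) + (\<Sum>v\<in>S. x' u v)" .
    have "{v\<in>U. E u v} = {v\<in>U - S. E u v} \<union> {v\<in>S. E u v}" using SU by blast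
    then have "card {v\<in>U. E u v} = card {v\<in>U - S. E u v} + card {v\<in>S. E u v}"
      using finU finS by (simp add: card_Un_disjoint Int_def disjoint_iff)
    moreover have "real (card {v\<in>S. E u v}) = (\<Sum>v\<in>S. x' u v + x' v u)"
      unfolding sum_indicator_E[OF finS, symmetric]
      using fx' by (intro sum.cong) (auto simp: fractional_def)
    ultimately show ?thesis
      unfolding pot_def 1 by (simp add: sum.distrib)
  qed
qed

lemma ex_maximal_indep:
  assumes "A \<subseteq> K" "K \<subseteq> V" "indep A"
  shows "\<exists>S. A \<subseteq> S \<and> S \<subseteq> K \<and> indep S \<and> (\<forall>u\<in>K - S. \<exists>s\<in>S. E s u)"
proof -
  let ?F = "{S. A \<subseteq> S \<and> S \<subseteq> K \<and> indep S}"
  have "finite ?F"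
    by (rule finite_subset[of _ "Pow V"]) (use assms finV in auto)
  then obtain S where S: "S \<in> ?F" "\<forall>B\<in>?F. S \<subseteq> B \<longrightarrow> S = B"
    using assms finite_has_maximal2[of ?F A] by auto
  have "\<exists>s\<in>S. E s u" if u: "u \<in> K - S" for u
  proof (rule ccontr)
    assume "\<not> ?thesis"
    then have "insert u S \<in> ?F"
      using S u E_commute unfolding indep_def by auto
    then show False using S u by blast
  qed
  with S show ?thesis by blast
qed

lemma indep_class: "indep {u\<in>A. c u = i}"
  unfolding indep_def using c_E by blast

text \<open>A member \<open>s\<close> of \<open>S\<close> reaches the value \<open>X\<close> by taking the fraction
  \<open>(X - outw s) / (pot s - outw s)\<close> of what others pay for its edges inside \<open>U\<close>.  As
  \<open>outw s \<le> k\<close> and \<open>l \<le> 1\<close>, the inequality \<open>l * (pot s - k) \<le> X - k\<close> persists when \<open>k\<close> is replaced by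
  \<open>outw s\<close>, so this fraction is at least \<open>l\<close>.  The fraction is \<open>1\<close> if \<open>pot s = X\<close>, which
  gives the last part of the conclusion.\<close>

lemma fractional_level:
  assumes st: "state (Suc X) T x U h" and XT: "X \<le> T"
    and oX: "\<And>s. s \<in> U \<Longrightarrow> real X \<le> pot x U s \<Longrightarrow> outw x s \<le> real X"
    and l0: "0 \<le> l" and l1: "l \<le> 1"
    and lk: "\<And>s. s \<in> U \<Longrightarrow> real X \<le> pot x U s \<Longrightarrow> l * (pot x U s - real k) \<le> real X - real k"
  shows "\<exists>x' U' h'. state X T x' U' h' \<and> U' \<subseteq> U \<and>
    (\<forall>u\<in>U'. pot x' U' u \<le> pot x U u \<and>
       (pot x U u < real X \<or> (c u \<noteq> i \<and> pot x' U' u \<le> pot x U u - l))) \<and>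
    ((\<forall>u\<in>U. pot x U u \<le> real X) \<longrightarrow> (\<forall>u v. x u v \<in> \<int>) \<longrightarrow> (\<forall>u v. x' u v \<in> \<int>))"
proof -
  have UV: "U \<subseteq> V" and fx: "fractional x" and outk: "\<And>u. u \<in> U \<Longrightarrow> outw x u \<le> real k"
    using st unfolding state_def by auto
  have finU: "finite U" by (rule finite_sub[OF UV])
  define K where "K = {u\<in>U. real X \<le> pot x U u}"
  have "\<exists>S. {u\<in>K. c u = i} \<subseteq> S \<and> S \<subseteq> K \<and> indep S \<and> (\<forall>u\<in>K - S. \<exists>s\<in>S. E s u)"
    by (rule ex_maximal_indep[OF _ _ indep_class]) (use UV in \<open>auto simp: K_def\<close>)
  then obtain S where S: "{u\<in>K. c u = i} \<subseteq> S" "S \<subseteq> K" "indep S"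
    and dom: "\<And>u. u \<in> K - S \<Longrightarrow> \<exists>s\<in>S. E s u" by blast
  have SU: "S \<subseteq> U" using S(2) unfolding K_def by auto
  have finS: "finite S" using SU finU by (rule finite_subset)
  \<comment> \<open>The value \<open>1\<close> avoids a division by zero; then \<open>X = outw x s\<close> and nothing has to be taken.\<close>
  define lam where "lam s = (if pot x U s = outw x s then 1
      else (real X - outw x s) / (pot x U s - outw x s))" for s
  have lam: "0 \<le> lam s" "lam s \<le> 1" "l \<le> lam s" 
      "outw x s + lam s * (pot x U s - outw x s) = real X" if s: "s \<in> S" for s
  proof -
    have sK: "s \<in> U" "real X \<le> pot x U s" using s S(2) unfolding K_def by auto
    have o: "outw x s \<le> real k" "outw x s \<le> real X" using outk oX sK by auto
    have "0 \<le> lam s \<and> lam s \<le> 1 \<and> l \<le> lam s \<and> outw x s + lam s * (pot x U s - outw x s) = real X"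
    proof (cases "pot x U s = outw x s")
      case True
      then have "real X = outw x s" using o sK by simp
      then show ?thesis using True l1 unfolding lam_def by simp
    next
      case False
      then have pos: "0 < pot x U s - outw x s" using outw_le_pot[OF fx UV, of s] by linarith
      have "l * (pot x U s - outw x s) = l * (pot x U s - real k) + l * (real k - outw x s)"
        by (simp add: algebra_simps)
      also have "\<dots> \<le> (real X - real k) + 1 * (real k - outw x s)"
        using lk[OF sK] o l1 by (intro add_mono mult_right_mono) auto
      finally have "l \<le> lam s" unfolding lam_def using False pos by (simp add: pos_le_divide_eq)
      then show ?thesis
        using False pos sK o unfolding lam_def by (auto simp: divide_le_eq)
    qed
    then show "0 \<le> lam s" "lam s \<le> 1" "l \<le> lam s"
      "outw x s + lam s * (pot x U s - outw x s) = real X" by auto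
  qed
  define x' where "x' u v = (if u \<in> S \<and> v \<in> U - S then x u v + lam u * x v u
     else if v \<in> S \<and> u \<in> U - S then (1 - lam v) * x u v else x u v)" for u v
  have fx': "fractional x'"
    unfolding fractional_def
  proof (intro allI conjI)
    show "0 \<le> x' u v" for u v
      unfolding x'_def using frac_nonneg[OF fx] lam by auto
    show "x' u v + x' v u = (if E u v then 1 else 0)" for u v
      using fx unfolding x'_def fractional_def by (auto simp: algebra_simps)
  qed
  have outS: "outw x' s = real X" if s: "s \<in> S" for s
  proof -
    have "outw x' s = (\<Sum>u\<in>V. x s u + (if u \<in> U - S then lam s * x u s else 0))"
      unfolding outw_def x'_def using s by (intro sum.cong) auto
    also have "\<dots> = outw x s + (\<Sum>u\<in>U - S. lam s * x u s)"
      unfolding outw_def sum.distrib using UV finV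
      by (subst sum.inter_restrict[symmetric]) (auto intro: arg_cong[of _ _ "sum _"] simp: Int_absorb1)
    also have "(\<Sum>u\<in>U - S. lam s * x u s) = (\<Sum>u\<in>U. lam s * x u s)"
      using S(3) s finU frac_nonedge[OF fx] unfolding indep_def
      by (intro sum.mono_neutral_left) auto
    also have "\<dots> = lam s * (pot x U s - outw x s)"
      by (simp add: pot_minus_out[OF fx UV] sum_distrib_left)
    finally show ?thesis using lam(4)[OF s] by simp
  qed
  have less: "x' u s \<le> x u s" if "u \<in> U - S" "s \<in> S" for u s
    unfolding x'_def using that lam[OF that(2)] frac_nonneg[OF fx, of u s]
    by (auto simp: algebra_simps)
  have peel: "state X T x' (U - S) (\<lambda>v. if v \<in> S then X else h v)"
    "\<And>u. u \<in> U - S \<Longrightarrow> pot x' (U - S) u = pot x U u - (\<Sum>s\<in>S. x' s u)"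
  proof -
    note * = state_peel[OF st XT SU S(3) fx' _ outS sum_mono[OF less]]
    show "state X T x' (U - S) (\<lambda>v. if v \<in> S then X else h v)"
      by (rule *(1)) (auto simp: x'_def)
    show "pot x' (U - S) u = pot x U u - (\<Sum>s\<in>S. x' s u)" if "u \<in> U - S" for u
      by (rule *(2)) (use that in \<open>auto simp: x'_def\<close>)
  qed
  have "pot x' (U - S) u \<le> pot x U u" if "u \<in> U - S" for u
    using peel(2)[OF that] frac_nonneg[OF fx'] by (simp add: sum_nonneg)
  moreover have "c u \<noteq> i \<and> pot x' (U - S) u \<le> pot x U u - l"
    if u: "u \<in> U - S" "\<not> pot x U u < real X" for u
  proof -
    have uK: "u \<in> K - S" using u unfolding K_def by auto
    then have ci: "c u \<noteq> i" using S(1) by auto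
    from dom[OF uK] obtain s where s: "s \<in> S" "E s u" by blast
    have "l \<le> lam s" by (rule lam(3)[OF s(1)])
    also have "lam s = lam s * x s u + lam s * x u s"
      using frac_edge[OF fx s(2)] by (simp flip: distrib_left)
    also have "\<dots> \<le> x s u + lam s * x u s"
      using mult_right_mono[OF lam(2)[OF s(1)] frac_nonneg[OF fx, of s u]] by simp
    also have "\<dots> = x' s u" using s u unfolding x'_def by auto
    also have "\<dots> \<le> (\<Sum>s\<in>S. x' s u)"
      using finS s(1) frac_nonneg[OF fx'] by (intro member_le_sum) auto
    finally show ?thesis using peel(2)[OF u(1)] ci by simp
  qed
  moreover have "\<forall>u v. x' u v \<in> \<int>"
    if "\<forall>u\<in>U. pot x U u \<le> real X" and int: "\<forall>u v. x u v \<in> \<int>"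
  proof -
    have "lam s = 1" if "s \<in> S" for s
    proof -
      have "pot x U s = real X"
        using \<open>\<forall>u\<in>U. pot x U u \<le> real X\<close> that S(2) unfolding K_def by force
      then show ?thesis unfolding lam_def by simp
    qed
    then show ?thesis using int unfolding x'_def by simp
  qed
  ultimately show ?thesis
    using peel(1) by (intro exI[of _ x'] exI[of _ "U - S"] exI[of _ "\<lambda>v. if v \<in> S then X else h v"]) blast
qed

section \<open>Rounding\<close>

lemma bij_edges_at:
  assumes ME: "\<And>u v. M u v \<Longrightarrow> E u v" and M_sym: "\<And>u v. M u v \<Longrightarrow> M v u"
  shows "bij_betw (\<lambda>u. {v, u}) {u\<in>V. M v u} {e \<in> {{u, w} |u w. M u w}. v \<in> e}"
  unfolding bij_betw_def
proof
  show "inj_on (\<lambda>u. {v, u}) {u\<in>V. M v u}"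
    by (auto simp: inj_on_def doubleton_eq_iff)
  show "(\<lambda>u. {v, u}) ` {u\<in>V. M v u} = {e \<in> {{u, w} |u w. M u w}. v \<in> e}"
    using ME M_sym E_V by (auto simp: image_iff insert_commute) blast+
qed

lemma finite_edges:
  assumes ME: "\<And>u v. M u v \<Longrightarrow> E u v"
  shows "finite {{u, w} |u w. M u w}"
  by (rule finite_subset[of _ "Pow V"]) (use ME E_V finV in auto)

lemma payer_sum:
  assumes ME: "\<And>u v. M u v \<Longrightarrow> E u v" and M_sym: "\<And>u v. M u v \<Longrightarrow> M v u"
  shows "(\<Sum>u | u \<in> V \<and> M v u. if \<phi> {v, u} = v then 1 else 0 :: real)
    = real (card {e \<in> {{u, w} |u w. M u w}. v \<in> e \<and> \<phi> e = v})"
proof -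
  have "(\<Sum>u | u \<in> V \<and> M v u. if \<phi> {v, u} = v then 1 else 0 :: real)
      = (\<Sum>e \<in> {e \<in> {{u, w} |u w. M u w}. v \<in> e}. if \<phi> e = v then 1 else 0)"
    by (rule sum.reindex_bij_betw[OF bij_edges_at[OF ME M_sym]])
  also have "\<dots> = real (card {e \<in> {{u, w} |u w. M u w}. v \<in> e \<and> \<phi> e = v})"
    using finite_edges[OF ME] by (simp add: sum.If_cases Int_def conj_ac)
  finally show ?thesis .
qed

text \<open>The edges of a symmetric subrelation \<open>M\<close> are items, to be assigned to the end that pays.\<close>

lemma rounding:
  assumes ME: "\<And>u v. M u v \<Longrightarrow> E u v" and M_sym: "\<And>u v. M u v \<Longrightarrow> M v u"
    and fx: "fractional x" and AV: "A \<subseteq> V"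
    and le: "\<And>v. v \<in> V \<Longrightarrow> (\<Sum>u | u \<in> V \<and> M v u. x v u) \<le> real (cap v)"
    and eq: "\<And>v. v \<in> A \<Longrightarrow> (\<Sum>u | u \<in> V \<and> M v u. x v u) = real (cap v)"
  shows "\<exists>y. fractional y \<and> (\<forall>u v. \<not> M u v \<longrightarrow> y u v = x u v) \<and> (\<forall>u v. M u v \<longrightarrow> y u v \<in> \<int>)
    \<and> (\<forall>v\<in>V. (\<Sum>u | u \<in> V \<and> M v u. y v u) \<le> real (cap v))
    \<and> (\<forall>v\<in>A. (\<Sum>u | u \<in> V \<and> M v u. y v u) = real (cap v))"
proof -
  define I where "I = {{u, w} |u w. M u w}"
  define g where "g e v = (\<Sum>u\<in>e - {v}. x v u)" for e v
  have M_ne: "u \<noteq> v" if "M u v" for u v using ME[OF that] by auto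
  have load: "(\<Sum>e | e \<in> I \<and> v \<in> e. g e v) = (\<Sum>u | u \<in> V \<and> M v u. x v u)" for v
  proof -
    have "(\<Sum>u | u \<in> V \<and> M v u. x v u) = (\<Sum>u | u \<in> V \<and> M v u. g {v, u} v)"
    proof (rule sum.cong[OF refl])
      fix u assume "u \<in> {u. u \<in> V \<and> M v u}"
      then have "{v, u} - {v} = {u}" using M_ne by auto
      then show "x v u = g {v, u} v" unfolding g_def by simp
    qed
    also have "\<dots> = (\<Sum>e \<in> {e \<in> {{u, w} |u w. M u w}. v \<in> e}. g e v)"
      by (rule sum.reindex_bij_betw[OF bij_edges_at[OF ME M_sym]])
    finally show ?thesis unfolding I_def by simp
  qed
  have "\<exists>\<phi>. (\<forall>e\<in>I. \<phi> e \<in> e) \<and> (\<forall>v\<in>V. card {e\<in>I. \<phi> e = v} \<le> cap v)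
    \<and> (\<forall>v\<in>A. card {e\<in>I. \<phi> e = v} = cap v)"
  proof (rule integral_assignment[where g = g, OF _ finV _ _ _ _ AV])
    show "finite I" unfolding I_def by (rule finite_edges[OF ME])
    show "e \<subseteq> V" if "e \<in> I" for e using that ME E_V unfolding I_def by auto
    show "0 \<le> g e v" for e v unfolding g_def by (intro sum_nonneg frac_nonneg[OF fx])
    show "(\<Sum>v\<in>e. g e v) = 1" if eI: "e \<in> I" for e
    proof -
      obtain u w where e: "e = {u, w}" "M u w" using eI unfolding I_def by blast
      have "u \<noteq> w" by (rule M_ne[OF e(2)])
      then have "{u, w} - {u} = {w}" "{u, w} - {w} = {u}" by auto
      then show ?thesis
        using \<open>u \<noteq> w\<close> frac_edge[OF fx ME[OF e(2)]] unfolding e g_def by simp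
    qed
    show "(\<Sum>e | e \<in> I \<and> v \<in> e. g e v) \<le> real (cap v)" if "v \<in> V" for v
      unfolding load by (rule le[OF that])
    show "(\<Sum>e | e \<in> I \<and> v \<in> e. g e v) = real (cap v)" if "v \<in> A" for v
      unfolding load by (rule eq[OF that])
  qed
  then obtain \<phi> where \<phi>: "\<And>e. e \<in> I \<Longrightarrow> \<phi> e \<in> e" "\<And>v. v \<in> V \<Longrightarrow> card {e\<in>I. \<phi> e = v} \<le> cap v"
    "\<And>v. v \<in> A \<Longrightarrow> card {e\<in>I. \<phi> e = v} = cap v" by blast
  define y where "y u v = (if M u v then if \<phi> {u, v} = u then 1 else 0 else x u v)" for u v
  have sum_y: "(\<Sum>u | u \<in> V \<and> M v u. y v u) = real (card {e\<in>I. \<phi> e = v})" for v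
  proof -
    have "(\<Sum>u | u \<in> V \<and> M v u. y v u)
        = (\<Sum>u | u \<in> V \<and> M v u. if \<phi> {v, u} = v then 1 else 0 :: real)"
      by (rule sum.cong) (simp_all add: y_def)
    also have "\<dots> = real (card {e \<in> {{u, w} |u w. M u w}. v \<in> e \<and> \<phi> e = v})"
      by (rule payer_sum[OF ME M_sym])
    also have "{e \<in> {{u, w} |u w. M u w}. v \<in> e \<and> \<phi> e = v} = {e\<in>I. \<phi> e = v}"
      using \<phi>(1) unfolding I_def by auto
    finally show ?thesis .
  qed
  have "fractional y"
    unfolding fractional_def
  proof (intro allI conjI)
    fix u v
    show "0 \<le> y u v" using frac_nonneg[OF fx] unfolding y_def by simp
    show "y u v + y v u = (if E u v then 1 else 0)"
    proof (cases "M u v")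
      case True
      then have "\<phi> {u, v} = u \<or> \<phi> {u, v} = v" using \<phi>(1)[of "{u, v}"] unfolding I_def by auto
      then show ?thesis
        using True M_sym M_ne[OF True] ME[OF True] unfolding y_def by (auto simp: insert_commute)
    next
      case False
      then show ?thesis using M_sym fx unfolding y_def fractional_def by auto
    qed
  qed
  moreover have "\<forall>u v. \<not> M u v \<longrightarrow> y u v = x u v" "\<forall>u v. M u v \<longrightarrow> y u v \<in> \<int>"
    unfolding y_def by auto
  moreover have "\<forall>v\<in>V. (\<Sum>u | u \<in> V \<and> M v u. y v u) \<le> real (cap v)"
    "\<forall>v\<in>A. (\<Sum>u | u \<in> V \<and> M v u. y v u) = real (cap v)"
    unfolding sum_y using \<phi>(2,3) by simp_all
  ultimately show ?thesis by blast
qed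

text \<open>An orientation with outdegrees at most \<open>k\<close> assigns each edge to one of its ends, as the tail;
  with capacity \<open>k\<close> everywhere, Hall's condition is the sparsity of the graph.\<close>

lemma initial_state:
  assumes sparse: "\<And>J. J \<subseteq> {{u, v} |u v. E u v} \<Longrightarrow> card J \<le> k * card (\<Union>J)"
  shows "\<exists>x. state (Suc T) T x V h"
proof -
  define I where "I = {{u, v} |u v. E u v}"
  have "\<exists>\<phi>. (\<forall>e\<in>I. \<phi> e \<in> e) \<and> (\<forall>v. card {e\<in>I. \<phi> e = v} \<le> k)"
  proof (rule hall_with_capacities)
    show "finite I" unfolding I_def by (rule finite_edges)
    show "finite e" if "e \<in> I" for e using that unfolding I_def by auto
    show "card J \<le> (\<Sum>v\<in>\<Union> ((\<lambda>e. e) ` J). k)" if "J \<subseteq> I" for J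
      using sparse[of J] that unfolding I_def by (simp add: mult.commute)
  qed
  then obtain \<phi> where \<phi>: "\<And>e. e \<in> I \<Longrightarrow> \<phi> e \<in> e" "\<And>v. card {e\<in>I. \<phi> e = v} \<le> k" by blast
  define x where "x u v = (if E u v then if \<phi> {u, v} = u then 1 else 0 else 0 :: real)" for u v
  have "outw x v \<le> real k" for v
  proof -
    have "outw x v = (\<Sum>u | u \<in> V \<and> E v u. if \<phi> {v, u} = v then 1 else 0 :: real)"
      unfolding outw_def x_def using finV by (simp add: sum.inter_filter)
    also have "\<dots> = real (card {e \<in> I. v \<in> e \<and> \<phi> e = v})"
      unfolding I_def by (rule payer_sum) (auto intro: E_sym)
    also have "{e \<in> I. v \<in> e \<and> \<phi> e = v} = {e \<in> I. \<phi> e = v}" using \<phi>(1) by auto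
    finally show ?thesis using \<phi>(2)[of v] by simp
  qed
  moreover have "fractional x"
    unfolding fractional_def
  proof (intro allI conjI)
    fix u v
    show "0 \<le> x u v" unfolding x_def by simp
    show "x u v + x v u = (if E u v then 1 else 0)"
    proof (cases "E u v")
      case True
      then have "\<phi> {u, v} = u \<or> \<phi> {u, v} = v" "u \<noteq> v"
        using \<phi>(1)[of "{u, v}"] unfolding I_def by auto
      then show ?thesis
        using True E_sym unfolding x_def by (auto simp: insert_commute)
    qed (use E_sym in \<open>auto simp: x_def\<close>)
  qed
  ultimately have "state (Suc T) T x V h" unfolding state_def by (auto simp: x_def)
  then show ?thesis by blast
qed

lemma sum_neighbours:
  assumes "fractional y" "B \<subseteq> V" "\<And>u. u \<in> V \<Longrightarrow> M v u \<longleftrightarrow> E v u \<and> u \<in> B"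
  shows "(\<Sum>u | u \<in> V \<and> M v u. y v u) = (\<Sum>u\<in>B. y v u)"
proof (rule sum.mono_neutral_left)
  show "finite B" by (rule finite_sub[OF assms(2)])
  show "{u. u \<in> V \<and> M v u} \<subseteq> B" using assms(3) by auto
  show "\<forall>u\<in>B - {u. u \<in> V \<and> M v u}. y v u = 0"
    using assms(2,3) frac_nonedge[OF assms(1)] by blast
qed

text \<open>Rounding the edges that meet a decided vertex.  Decided vertices keep their values exactly.
  An undecided vertex \<open>v\<close> pays at most \<open>\<lceil>a v\<rceil>\<close> to decided ones if it paid \<open>a v\<close> before; as its other
  payments and its undecided degree are integers, \<open>outw v \<le> k\<close> and \<open>pot v < Z + 2\<close> turn into the
  corresponding bounds for \<open>\<lceil>a v\<rceil>\<close>.\<close>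

lemma integralise:
  assumes st: "state X T x U h" and bound: "\<And>u. u \<in> U \<Longrightarrow> pot x U u < real Z + 2"
  shows "\<exists>y. state X T y U h \<and> (\<forall>u v. y u v \<in> \<int>) \<and> (\<forall>u\<in>U. pot y U u \<le> real Z + 2)"
proof -
  have UV: "U \<subseteq> V" and fx: "fractional x" using st unfolding state_def by auto
  have finU: "finite U" by (rule finite_sub[OF UV])
  define M where "M u v \<longleftrightarrow> E u v \<and> \<not> (u \<in> U \<and> v \<in> U)" for u v
  define a where "a v = (\<Sum>u\<in>V - U. x v u)" for v
  define cap where "cap v = (if v \<in> U then nat \<lceil>a v\<rceil> else h v)" for v
  have a0: "0 \<le> a v" for v unfolding a_def by (intro sum_nonneg frac_nonneg[OF fx])
  have MU: "(\<Sum>u | u \<in> V \<and> M v u. z v u) = (\<Sum>u\<in>V - U. z v u)" if "fractional z" "v \<in> U" for z v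
    by (rule sum_neighbours[OF that(1)]) (use that(2) in \<open>auto simp: M_def\<close>)
  have MV: "(\<Sum>u | u \<in> V \<and> M v u. z v u) = outw z v" if "fractional z" "v \<in> V - U" for z v
    unfolding outw_def by (rule sum_neighbours[OF that(1)]) (use that(2) in \<open>auto simp: M_def\<close>)
  have "\<exists>y. fractional y \<and> (\<forall>u v. \<not> M u v \<longrightarrow> y u v = x u v) \<and> (\<forall>u v. M u v \<longrightarrow> y u v \<in> \<int>)
    \<and> (\<forall>v\<in>V. (\<Sum>u | u \<in> V \<and> M v u. y v u) \<le> real (cap v))
    \<and> (\<forall>v\<in>V - U. (\<Sum>u | u \<in> V \<and> M v u. y v u) = real (cap v))"
  proof (rule rounding[OF _ _ fx])
    show "E u v" if "M u v" for u v using that unfolding M_def by blast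
    show "M v u" if "M u v" for u v using that E_sym unfolding M_def by blast
    show "V - U \<subseteq> V" by blast
    show eq: "(\<Sum>u | u \<in> V \<and> M v u. x v u) = real (cap v)" if "v \<in> V - U" for v
      using that st MV[OF fx that] unfolding cap_def state_def by auto
    show "(\<Sum>u | u \<in> V \<and> M v u. x v u) \<le> real (cap v)" if "v \<in> V" for v
    proof (cases "v \<in> U")
      case True
      have "a v \<le> real (nat \<lceil>a v\<rceil>)" by (rule real_nat_ceiling_ge)
      then show ?thesis using True MU[OF fx True] unfolding cap_def a_def by simp
    next
      case False
      then show ?thesis using eq[of v] that by simp
    qed
  qed
  then obtain y where fy: "fractional y" and off: "\<And>u v. \<not> M u v \<Longrightarrow> y u v = x u v"
    and int: "\<And>u v. M u v \<Longrightarrow> y u v \<in> \<int>"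
    and le: "\<And>v. v \<in> V \<Longrightarrow> (\<Sum>u | u \<in> V \<and> M v u. y v u) \<le> real (cap v)"
    and eq: "\<And>v. v \<in> V - U \<Longrightarrow> (\<Sum>u | u \<in> V \<and> M v u. y v u) = real (cap v)" by blast
  have yU: "(\<Sum>u\<in>V - U. y v u) \<le> of_int \<lceil>a v\<rceil>" if "v \<in> U" for v
  proof -
    have "real (nat \<lceil>a v\<rceil>) = of_int \<lceil>a v\<rceil>" using a0[of v] by simp
    then show ?thesis using le[of v] that UV MU[OF fy that] unfolding cap_def by auto
  qed
  have yint: "y u v \<in> \<int>" for u v
  proof (cases "M u v")
    case False
    then show ?thesis
      using off[OF False] st frac_nonedge[OF fx, of u v] unfolding M_def state_def
      by (cases "E u v") auto
  qed (rule int)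
  have xint: "x u v \<in> \<int>" if "u \<in> U" "v \<in> U" for u v
    using st that unfolding state_def by blast
  have "outw y v \<le> real k" if v: "v \<in> U" for v
  proof -
    have split: "outw z v = (\<Sum>u\<in>V - U. z v u) + (\<Sum>u\<in>U. z v u)" for z
      unfolding outw_def using sum.subset_diff[OF UV finV] by simp
    have "(\<Sum>u\<in>U. x v u) \<in> \<int>" using xint[OF v] by (intro Ints_sum)
    then obtain n where n: "(\<Sum>u\<in>U. x v u) = of_int n" by (elim Ints_cases)
    have "outw x v \<le> real k" using st v unfolding state_def by blast
    then have "a v \<le> of_int (int k - n)" using split[of x] n unfolding a_def by simp
    then have "\<lceil>a v\<rceil> \<le> int k - n" by (simp only: ceiling_le_iff)
    then have "of_int \<lceil>a v\<rceil> \<le> real k - of_int n" by linarith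
    moreover have "(\<Sum>u\<in>U. y v u) = of_int n"
      unfolding n[symmetric] using v by (intro sum.cong refl off) (auto simp: M_def)
    ultimately show ?thesis using split[of y] yU[OF v] by linarith
  qed
  moreover have "outw y v = real (h v)" if "v \<in> V - U" for v
    using eq[OF that] MV[OF fy that] that unfolding cap_def by simp
  ultimately have "state X T y U h"
    using st fy yint unfolding state_def by auto
  moreover have "pot y U v \<le> real Z + 2" if v: "v \<in> U" for v
  proof -
    have "a v \<le> of_int (int Z + 2 - int (card {u\<in>U. E v u}))"
      using bound[OF v] unfolding pot_def a_def by simp
    then have "\<lceil>a v\<rceil> \<le> int Z + 2 - int (card {u\<in>U. E v u})" by (simp only: ceiling_le_iff)
    then show ?thesis using yU[OF v] unfolding pot_def by linarith
  qed
  ultimately show ?thesis using yint by blast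
qed

section \<open>Fractional phases\<close>

text \<open>The first \<open>i\<close> levels of a phase, where level \<open>X - j\<close> serves the colour class \<open>j\<close>.  A vertex loses at
  least \<open>l = 1 - d\<close> per level while it is at or above the level, so its distance to
  the level grows by at most \<open>d\<close>.  When its class is served, it is either decided or already
  below the level.\<close>

lemma fractional_levels:
  assumes st: "state (Suc X) T x U h" and XT: "X \<le> T"
    and room: "k + Y + r \<le> Suc X" and rX: "r \<le> X" and B1: "1 \<le> B"
    and bound: "\<And>u. u \<in> U \<Longrightarrow> pot x U u < real X + B"
    and l0: "0 \<le> l" and l1: "l \<le> 1" and d: "d = 1 - l"
    and lY: "l * (real Y + B + real r * d) \<le> real Y"
    and i: "i \<le> r"
  shows "\<exists>x' U' h'. state (Suc (X - i)) T x' U' h' \<and>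
    (\<forall>u\<in>U'. pot x' U' u < real X - real i +
       (if c u < i then 1 + (real i - 1 - real (c u)) * d else B + real i * d))"
  using i
proof (induction i)
  case 0
  show ?case using st bound by (intro exI[of _ x] exI[of _ U] exI[of _ h]) simp
next
  case (Suc i)
  then obtain x' U' h' where st': "state (Suc (X - i)) T x' U' h'"
    and b: "\<And>u. u \<in> U' \<Longrightarrow> pot x' U' u < real X - real i +
       (if c u < i then 1 + (real i - 1 - real (c u)) * d else B + real i * d)" by force
  define Z where "Z = X - i"
  have iX: "real X - real i = real Z" "Z \<le> T" "k \<le> Z" "real Y \<le> real Z - real k" "Suc (X - Suc i) = Z"
    using Suc.prems rX XT room unfolding Z_def by linarith+
  have d0: "0 \<le> d" "d \<le> 1" using l0 l1 d by auto
  have bM: "pot x' U' u \<le> real Z + (B + real r * d)" if "u \<in> U'" for u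
  proof (cases "c u < i")
    case True
    then have "1 + (real i - 1 - real (c u)) * d \<le> B + real r * d"
      using Suc.prems B1 d0 by (intro add_mono mult_right_mono) auto
    then show ?thesis using b[OF that] True iX(1) by simp
  next
    case False
    have "real i * d \<le> real r * d" using Suc.prems d0 by (intro mult_right_mono) auto
    then show ?thesis using b[OF that] False iX(1) by simp
  qed
  have lk: "l * (pot x' U' s - real k) \<le> real Z - real k" if "s \<in> U'" for s
  proof -
    have "l * (pot x' U' s - real k) \<le> l * ((real Z - real k) + (B + real r * d))"
      using bM[OF that] l0 by (intro mult_left_mono) auto
    also have "\<dots> = l * (real Y + B + real r * d) + l * (real Z - real k - real Y)"
      by (simp add: algebra_simps)
    also have "\<dots> \<le> real Y + 1 * (real Z - real k - real Y)"
      using lY l1 iX(4) by (intro add_mono mult_right_mono) auto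
    finally show ?thesis by simp
  qed
  have "\<exists>x'' U'' h''. state Z T x'' U'' h'' \<and> U'' \<subseteq> U' \<and>
    (\<forall>u\<in>U''. pot x'' U'' u \<le> pot x' U' u \<and>
       (pot x' U' u < real Z \<or> (c u \<noteq> i \<and> pot x'' U'' u \<le> pot x' U' u - l))) \<and>
    ((\<forall>u\<in>U'. pot x' U' u \<le> real Z) \<longrightarrow> (\<forall>u v. x' u v \<in> \<int>) \<longrightarrow> (\<forall>u v. x'' u v \<in> \<int>))"
  proof (rule fractional_level[OF _ iX(2) _ l0 l1 lk])
    show "state (Suc Z) T x' U' h'" using st' unfolding Z_def .
    show "outw x' s \<le> real Z" if "s \<in> U'" for s
      using st' that iX(3) unfolding state_def by force
  qed
  then obtain x'' U'' h'' where st'': "state Z T x'' U'' h''" and sub: "U'' \<subseteq> U'"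
    and step: "\<And>u. u \<in> U'' \<Longrightarrow> pot x'' U'' u \<le> pot x' U' u"
      "\<And>u. u \<in> U'' \<Longrightarrow> pot x' U' u < real Z \<or> (c u \<noteq> i \<and> pot x'' U'' u \<le> pot x' U' u - l)"
    by blast
  have "pot x'' U'' u < real X - real (Suc i) +
       (if c u < Suc i then 1 + (real (Suc i) - 1 - real (c u)) * d else B + real (Suc i) * d)"
    if u: "u \<in> U''" for u
  proof (cases "pot x' U' u < real Z")
    case True
    have "0 \<le> (if c u < Suc i then (real (Suc i) - 1 - real (c u)) * d else B - 1 + real (Suc i) * d)"
      using d0 B1 by auto
    then show ?thesis using True step(1)[OF u] iX(1) by (auto split: if_splits)
  next
    case False
    then have "c u \<noteq> i" "pot x'' U'' u \<le> pot x' U' u - 1 + d" using step(2)[OF u] d by auto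
    moreover have "pot x' U' u < real Z +
       (if c u < i then 1 + (real i - 1 - real (c u)) * d else B + real i * d)"
      using b[of u] u sub iX(1) by auto
    ultimately show ?thesis using iX(1) by (auto simp: algebra_simps split: if_splits)
  qed
  then show ?case using st'' unfolding iX(5) by blast
qed

text \<open>The least favourable class after a phase is the one served first: it has spent \<open>r - 1\<close>
  further levels drifting upwards by \<open>d\<close>.\<close>

lemma phase:
  assumes "state (Suc X) T x U h" "X \<le> T" "k + Y + r \<le> Suc X" "r \<le> X" "1 \<le> B"
    and "\<And>u. u \<in> U \<Longrightarrow> pot x U u < real X + B"
    and "0 \<le> d" "d \<le> 1" "(1 - d) * (real Y + B + real r * d) \<le> real Y"
  shows "\<exists>x' U' h'. state (Suc (X - r)) T x' U' h' \<and>
    (\<forall>u\<in>U'. pot x' U' u < real (X - r) + (1 + (real r - 1) * d))"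
proof -
  obtain x' U' h' where st: "state (Suc (X - r)) T x' U' h'"
    and b: "\<And>u. u \<in> U' \<Longrightarrow> pot x' U' u < real X - real r +
       (if c u < r then 1 + (real r - 1 - real (c u)) * d else B + real r * d)"
    using fractional_levels[OF assms(1-6), of "1 - d" d r] assms(7-9) by auto
  have "pot x' U' u < real (X - r) + (1 + (real r - 1) * d)" if u: "u \<in> U'" for u
  proof -
    have "c u < r" using st u c_less unfolding state_def by blast
    moreover have "(real r - 1 - real (c u)) * d \<le> (real r - 1) * d"
      using assms(7) by (intro mult_right_mono) auto
    ultimately show ?thesis using b[OF u] assms(4) by (simp add: of_nat_diff)
  qed
  with st show ?thesis by blast
qed

text \<open>The bound \<open>r / q ^ m + q / (q - 1)\<close> satisfies the recursion \<open>B \<mapsto> 1 + B / q\<close>, of which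
  \<open>q / (q - 1)\<close> is the fixed point.\<close>

lemma phases:
  fixes t :: nat
  defines "q \<equiv> 2 * real t + 1"
  assumes st: "state (Suc X) T x U h" and XT: "X \<le> T"
    and room: "k + 2 * r * (t + 1) + m * r \<le> Suc X" and r: "1 \<le> r" and t: "1 \<le> t"
    and bound: "\<And>u. u \<in> U \<Longrightarrow> pot x U u < real X + (real r + q / (q - 1))"
  shows "\<exists>x' U' h'. state (Suc (X - m * r)) T x' U' h' \<and>
    (\<forall>u\<in>U'. pot x' U' u < real (X - m * r) + (real r / q ^ m + q / (q - 1)))"
  using room
proof (induction m)
  case 0
  then show ?case using st bound by (intro exI[of _ x] exI[of _ U] exI[of _ h]) simp
next
  case (Suc m)
  then obtain x' U' h' where st': "state (Suc (X - m * r)) T x' U' h'"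
    and b: "\<And>u. u \<in> U' \<Longrightarrow> pot x' U' u < real (X - m * r) + (real r / q ^ m + q / (q - 1))"
    by force
  define Z where "Z = X - m * r"
  define B where "B = real r / q ^ m + q / (q - 1)"
  \<comment> \<open>For this \<open>d\<close> and \<open>Y = r q + r\<close> one has \<open>d Y = B + r d\<close>, so \<open>(1 - d) (Y + B + r d) \<le> Y\<close>.\<close>
  define d where "d = B / (real r * q)"
  have q3: "3 \<le> q" using t unfolding q_def by simp
  have qq: "q / (q - 1) = 1 + 1 / (q - 1)" "1 / (q - 1) \<le> 1 / 2"
    using q3 by (auto simp: field_simps)
  have rq: "real r / q ^ m \<le> real r" "0 \<le> real r / q ^ m"
    using q3 by (auto simp: divide_le_eq mult_le_cancel_left1 one_le_power)
  have B: "1 \<le> B" "B \<le> real r * q"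
  proof -
    show "1 \<le> B" unfolding B_def qq(1) using rq q3 by (simp add: add_increasing)
    have "B \<le> real r + 2" unfolding B_def qq(1) using rq qq(2) by simp
    also have "\<dots> \<le> real r * 3" using r by simp
    also have "\<dots> \<le> real r * q" using q3 by (intro mult_left_mono) auto
    finally show "B \<le> real r * q" .
  qed
  have rq0: "0 < real r * q" using r q3 by simp
  have d: "0 \<le> d" "d \<le> 1" "B = d * (real r * q)"
    unfolding d_def using B rq0 r by (auto simp: divide_le_eq)
  have "\<exists>x'' U'' h''. state (Suc (Z - r)) T x'' U'' h'' \<and>
    (\<forall>u\<in>U''. pot x'' U'' u < real (Z - r) + (1 + (real r - 1) * d))"
  proof (rule phase[where Y = "2 * r * (t + 1)" and B = B])
    show "state (Suc Z) T x' U' h'" using st' unfolding Z_def .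
    show "Z \<le> T" using XT unfolding Z_def by simp
    show "k + 2 * r * (t + 1) + r \<le> Suc Z" using Suc.prems unfolding Z_def by simp
    have "r * 1 \<le> r * (t + 1)" by (intro mult_le_mono2) simp
    moreover have "2 * r * (t + 1) = r * (t + 1) + r * (t + 1)" by simp
    ultimately show "r \<le> Z" using Suc.prems r unfolding Z_def by simp
    show "1 \<le> B" "0 \<le> d" "d \<le> 1" by fact+
    show "pot x' U' u < real Z + B" if "u \<in> U'" for u
      using b[OF that] unfolding Z_def B_def .
    have Y: "real (2 * r * (t + 1)) = real r * q + real r" unfolding q_def by (simp add: algebra_simps)
    have "(1 - d) * (real (2 * r * (t + 1)) + B + real r * d)
        = real (2 * r * (t + 1)) - d * B - real r * d * d"
      unfolding Y using d(3) by (simp add: algebra_simps)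
    also have "\<dots> \<le> real (2 * r * (t + 1))"
      using mult_nonneg_nonneg[OF d(1), of B] mult_nonneg_nonneg[OF mult_nonneg_nonneg[OF _ d(1)] d(1), of "real r"] B(1)
      by linarith
    finally show "(1 - d) * (real (2 * r * (t + 1)) + B + real r * d) \<le> real (2 * r * (t + 1))" .
  qed
  then obtain x'' U'' h'' where st'': "state (Suc (Z - r)) T x'' U'' h''"
    and b'': "\<And>u. u \<in> U'' \<Longrightarrow> pot x'' U'' u < real (Z - r) + (1 + (real r - 1) * d)" by blast
  have Zr: "Z - r = X - Suc m * r" unfolding Z_def by simp
  have "1 + (real r - 1) * d \<le> 1 + real r * d" using d by (simp add: left_diff_distrib)
  also have "\<dots> = 1 + B / q" unfolding d_def using r by simp
  also have "\<dots> = real r / q ^ Suc m + q / (q - 1)"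
    unfolding B_def using q3 by (simp add: field_simps)
  finally have "1 + (real r - 1) * d \<le> real r / q ^ Suc m + q / (q - 1)" .
  then show ?case using st'' b'' unfolding Zr by (intro exI[of _ x''] exI[of _ U''] exI[of _ h'']) force
qed

section \<open>Integral sweeps\<close>

lemma Ints_less_of_nat:
  assumes "a \<in> \<int>" "a < real n"
  shows "a \<le> real n - 1"
proof -
  obtain z where z: "a = of_int z" using assms(1) by (elim Ints_cases)
  then have "of_int z < (of_int (int n) :: real)" using assms(2) by simp
  then have "z \<le> int n - 1" by (simp only: of_int_less_iff)
  then have "of_int z \<le> (of_int (int n - 1) :: real)" by (simp only: of_int_le_iff)
  then show ?thesis using z by simp
qed

text \<open>The exchange property of an independent set of maximum weight: replacing the neighbours
  of \<open>Q\<close> by \<open>Q\<close> does not increase the weight.\<close>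

lemma max_weight_indep:
  fixes w :: "'a \<Rightarrow> nat"
  assumes KV: "K \<subseteq> V"
  shows "\<exists>S. S \<subseteq> K \<and> indep S \<and>
    (\<forall>Q. Q \<subseteq> K - S \<longrightarrow> indep Q \<longrightarrow> sum w Q \<le> sum w {s\<in>S. \<exists>q\<in>Q. E s q})"
proof -
  define F where "F = {S. S \<subseteq> K \<and> indep S}"
  have finK: "finite K" by (rule finite_sub[OF KV])
  have finF: "finite F" unfolding F_def by (rule finite_subset[of _ "Pow K"]) (use finK in auto)
  have "{} \<in> F" unfolding F_def indep_def by simp
  then have "Max (sum w ` F) \<in> sum w ` F" using finF by (intro Max_in) auto
  then obtain S where S: "S \<in> F" "sum w S = Max (sum w ` F)" by auto
  have best: "sum w S' \<le> sum w S" if "S' \<in> F" for S'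
    unfolding S(2) using finF that by (intro Max_ge) auto
  have "sum w Q \<le> sum w {s\<in>S. \<exists>q\<in>Q. E s q}" if Q: "Q \<subseteq> K - S" "indep Q" for Q
  proof -
    let ?R = "{s\<in>S. \<exists>q\<in>Q. E s q}"
    have fin: "finite S" "finite Q" using S(1) Q(1) finK unfolding F_def by (auto intro: finite_subset)
    have "(S - ?R) \<union> Q \<in> F"
      using S(1) Q E_commute unfolding F_def indep_def by blast
    then have "sum w ((S - ?R) \<union> Q) \<le> sum w S" by (rule best)
    moreover have "sum w ((S - ?R) \<union> Q) = sum w (S - ?R) + sum w Q"
      using fin Q(1) by (intro sum.union_disjoint) auto
    moreover have "sum w S = sum w (S - ?R) + sum w ?R"
      using fin by (intro sum.subset_diff) auto
    ultimately show ?thesis by simp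
  qed
  then show ?thesis using S(1) unfolding F_def by blast
qed

lemma sum_eq_card:
  fixes w :: "'a \<Rightarrow> nat"
  assumes "\<And>v. v \<in> A \<Longrightarrow> w v = 1"
  shows "sum w A = card A"
proof -
  have "sum w A = (\<Sum>v\<in>A. 1)" using assms by (rule sum.cong[OF refl])
  then show ?thesis by simp
qed

text \<open>Vertices outside the class \<open>i\<close> have weight \<open>1\<close>.  A vertex \<open>v\<close> of the class \<open>i\<close> has all its neighbours
  outside this class, so the exchange property for \<open>{v}\<close> counts them.  For the second claim,
  let \<open>Q\<close> be the set of those neighbours \<open>u\<close> of \<open>s\<close> in one colour class that have exactly \<open>w u\<close>
  neighbours in \<open>S\<close>.  If the class is not \<open>i\<close>, then \<open>s\<close> is the only neighbour of \<open>Q\<close> in \<open>S\<close>, and the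
  exchange property gives \<open>card Q \<le> w s \<le> 3\<close>.  If it is \<open>i\<close>, then \<open>Q\<close> has at most
  \<open>1 + (\<Sum>u\<in>Q. w u - 1)\<close> neighbours in \<open>S\<close>, and the exchange property gives \<open>card Q \<le> 1\<close>.\<close>

lemma tight_neighbours:
  fixes w :: "'a \<Rightarrow> nat"
  assumes KV: "K \<subseteq> V" and SK: "S \<subseteq> K" and indS: "indep S"
    and swap: "\<And>Q. Q \<subseteq> K - S \<Longrightarrow> indep Q \<Longrightarrow> sum w Q \<le> sum w {s\<in>S. \<exists>q\<in>Q. E s q}"
    and w1: "\<And>v. c v \<noteq> i \<Longrightarrow> w v = 1"
    and w13: "\<And>v. v \<in> K \<Longrightarrow> 1 \<le> w v \<and> w v \<le> 3"
  shows "\<And>v. v \<in> K - S \<Longrightarrow> w v \<le> card {s\<in>S. E s v}"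
    and "\<And>s. s \<in> S \<Longrightarrow> card {u\<in>K - S. E s u \<and> card {s'\<in>S. E s' u} = w u} \<le> 3 * (r - 1)"
proof -
  have finK: "finite K" by (rule finite_sub[OF KV])
  then have finS: "finite S" using SK by (rule rev_finite_subset)
  show "w v \<le> card {s\<in>S. E s v}" if v: "v \<in> K - S" for v
  proof -
    have "sum w {v} \<le> sum w {s\<in>S. \<exists>q\<in>{v}. E s q}"
      using v by (intro swap) (auto simp: indep_def)
    then have *: "w v \<le> sum w {s\<in>S. E s v}" by simp
    show ?thesis
    proof (cases "c v = i")
      case True
      then have "w s = 1" if "s \<in> {s\<in>S. E s v}" for s
        using c_E[of s v] that by (intro w1) auto
      then have "sum w {s\<in>S. E s v} = card {s\<in>S. E s v}" by (rule sum_eq_card)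
      with * show ?thesis by simp
    next
      case False
      have "{s\<in>S. E s v} \<noteq> {}" using * w13[of v] v by (metis DiffD1 not_one_le_zero le_trans sum.empty)
      then show ?thesis using w1[OF False] finS by (simp add: Suc_le_eq card_gt_0_iff)
    qed
  qed
  fix s assume s: "s \<in> S"
  define Q where "Q j = {u\<in>K - S. E s u \<and> card {s'\<in>S. E s' u} = w u \<and> c u = j}" for j
  have finQ: "finite (Q j)" for j unfolding Q_def using finK by auto
  have Q3: "card (Q j) \<le> 3" for j
  proof -
    define R where "R = {s'\<in>S. \<exists>q\<in>Q j. E s' q}"
    have QR: "sum w (Q j) \<le> sum w R"
      unfolding R_def
    proof (rule swap)
      show "Q j \<subseteq> K - S" unfolding Q_def by auto
      show "indep (Q j)" unfolding Q_def indep_def using c_E by blast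
    qed
    show ?thesis
    proof (cases "j = i")
      case False
      have "R \<subseteq> {s}"
      proof
        fix s' assume "s' \<in> R"
        then obtain q where q: "s' \<in> S" "q \<in> Q j" "E s' q" unfolding R_def by blast
        have "w q = 1" using q(2) False unfolding Q_def by (intro w1) auto
        then have "card {s'\<in>S. E s' q} = 1" using q(2) unfolding Q_def by auto
        then obtain z where "{s'\<in>S. E s' q} = {z}" by (auto simp: card_1_singleton_iff)
        moreover have "s \<in> {s'\<in>S. E s' q}" "s' \<in> {s'\<in>S. E s' q}"
          using s q unfolding Q_def by auto
        ultimately show "s' \<in> {s}" by auto
      qed
      then have "sum w R \<le> sum w {s}" by (intro sum_mono2) auto
      also have "\<dots> \<le> 3" using w13[of s] s SK by auto
      finally have "sum w R \<le> 3" .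
      moreover have "sum w (Q j) = card (Q j)"
      proof -
        have "w q = 1" if "q \<in> Q j" for q
          using that False unfolding Q_def by (intro w1) auto
        then show ?thesis by (rule sum_eq_card)
      qed
      ultimately show ?thesis using QR by simp
    next
      case True
      have wR: "w s' = 1" if "s' \<in> R" for s'
        using that c_E True unfolding R_def Q_def by (intro w1) auto
      have "sum w R = card R" using wR by (rule sum_eq_card)
      also have "card R \<le> card ({s} \<union> (\<Union>q\<in>Q j. {s'\<in>S. E s' q} - {s}))"
        using finQ finS unfolding R_def by (intro card_mono) auto
      also have "\<dots> \<le> card {s} + card (\<Union>q\<in>Q j. {s'\<in>S. E s' q} - {s})" by (rule card_Un_le)
      also have "card (\<Union>q\<in>Q j. {s'\<in>S. E s' q} - {s}) \<le> (\<Sum>q\<in>Q j. card ({s'\<in>S. E s' q} - {s}))"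
        by (rule card_UN_le[OF finQ])
      also have "\<dots> = (\<Sum>q\<in>Q j. w q - 1)"
      proof (rule sum.cong[OF refl])
        fix q assume q: "q \<in> Q j"
        then have "s \<in> {s'\<in>S. E s' q}" using s unfolding Q_def by auto
        then show "card ({s'\<in>S. E s' q} - {s}) = w q - 1"
          using q finS unfolding Q_def by (subst card_Diff_singleton) auto
      qed
      finally have "sum w (Q j) \<le> 1 + (\<Sum>q\<in>Q j. w q - 1)" using QR by simp
      moreover have "sum w (Q j) = (\<Sum>q\<in>Q j. (w q - 1) + 1)"
        using w13 unfolding Q_def by (intro sum.cong) force+
      moreover have "(\<Sum>q\<in>Q j. (w q - 1) + 1) = (\<Sum>q\<in>Q j. w q - 1) + card (Q j)"
        by (simp only: sum.distrib card_eq_sum)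
      ultimately show ?thesis by linarith
    qed
  qed
  have "{u\<in>K - S. E s u \<and> card {s'\<in>S. E s' u} = w u} \<subseteq> (\<Union>j\<in>{..<r} - {c s}. Q j)"
    using KV c_less c_E[of s] unfolding Q_def by fastforce
  then have "card {u\<in>K - S. E s u \<and> card {s'\<in>S. E s' u} = w u} \<le> card (\<Union>j\<in>{..<r} - {c s}. Q j)"
    using finQ by (intro card_mono) auto
  also have "\<dots> \<le> (\<Sum>j\<in>{..<r} - {c s}. card (Q j))" by (rule card_UN_le) auto
  also have "\<dots> \<le> (\<Sum>j\<in>{..<r} - {c s}. 3)" by (intro sum_mono Q3)
  also have "\<dots> = 3 * (r - 1)"
    using c_less[of s] s SK KV by (simp add: subset_iff)
  finally show "card {u\<in>K - S. E s u \<and> card {s'\<in>S. E s' u} = w u} \<le> 3 * (r - 1)" .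
qed

text \<open>A member \<open>s\<close> of \<open>S\<close> must leave \<open>e s = pot s - X \<le> 2\<close> of its edges to its neighbours, while
  every \<open>u \<in> K - S\<close> must be relieved of \<open>w u\<close> edges.  Neighbours that have no more than \<open>w u\<close> edges to
  \<open>S\<close> must not be left any; there are at most \<open>3 (r - 1)\<close> of them at \<open>s\<close>, so more than \<open>e s + 5\<close> of the
  edges paid by others remain.  Spread evenly over these, \<open>e s\<close> is at most \<open>1/4\<close> per edge.  Then \<open>u\<close>
  is left at most a quarter of its edges to \<open>S\<close>, which is within its bound if there are at least
  \<open>w u + 1\<close> of them, because \<open>w u \<le> 3\<close>.  Rounding gives an integral solution with the same bounds.\<close>

lemma sweep_payments:
  assumes st: "state (Suc X) T x U h" and int: "\<And>u v. x u v \<in> \<int>"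
    and room: "k + 3 * r + 3 \<le> X" and bound: "\<And>u. u \<in> U \<Longrightarrow> pot x U u \<le> real X + 2"
    and K: "K = {u\<in>U. real X \<le> pot x U u}"
    and SK: "S \<subseteq> K" and indS: "indep S" and w3: "\<And>v. v \<in> K \<Longrightarrow> w v \<le> 3"
    and dw: "\<And>v. v \<in> K - S \<Longrightarrow> w v \<le> card {s\<in>S. E s v}"
    and tight: "\<And>s. s \<in> S \<Longrightarrow> card {u\<in>K - S. E s u \<and> card {s'\<in>S. E s' u} = w u} \<le> 3 * (r - 1)"
  shows "\<exists>y. fractional y \<and> (\<forall>u v. \<not> (u \<in> S \<and> v \<in> U - S) \<longrightarrow> \<not> (v \<in> S \<and> u \<in> U - S) \<longrightarrow> y u v = x u v)
    \<and> (\<forall>s\<in>S. outw y s = real X) \<and> (\<forall>u\<in>U - S. (\<Sum>s\<in>S. y u s) \<le> (\<Sum>s\<in>S. x u s))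
    \<and> (\<forall>u\<in>K - S. (\<Sum>s\<in>S. y u s) \<le> real (card {s\<in>S. E s u}) - real (w u))
    \<and> (\<forall>u v. y u v \<in> \<int>)"
proof -
  have UV: "U \<subseteq> V" and fx: "fractional x" and outk: "\<And>u. u \<in> U \<Longrightarrow> outw x u \<le> real k"
    using st unfolding state_def by auto
  have finU: "finite U" by (rule finite_sub[OF UV])
  have SU: "S \<subseteq> U" using SK K by auto
  have finS: "finite S" using SU finU by (rule finite_subset)
  \<comment> \<open>\<open>T' s\<close>: the neighbours to which \<open>s\<close> must not leave anything; \<open>q s u\<close>: the share of the edge \<open>s u\<close> left to \<open>u\<close>.\<close>
  define T' where "T' s = {u\<in>K - S. E s u \<and> card {s'\<in>S. E s' u} = w u}" for s
  define F where "F s = {u\<in>U - S. x u s = 1} - T' s" for s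
  define e where "e s = pot x U s - real X" for s
  define q where "q s u = (if u \<in> F s then e s / real (card (F s)) else 0)" for s u
  have e: "0 \<le> e s" "e s \<le> 2" if "s \<in> S" for s
    using that SK K bound[of s] unfolding e_def by auto
  have finF: "finite (F s)" for s unfolding F_def using finU by auto
  have cardF: "4 * e s \<le> real (card (F s))" "0 < real (card (F s))" if s: "s \<in> S" for s
  proof -
    have r1: "1 \<le> r" using c_less[of s] s SU UV by force
    have "pot x U s - outw x s = (\<Sum>u\<in>U. x u s)" by (rule pot_minus_out[OF fx UV])
    also have "\<dots> = (\<Sum>u\<in>U - S. x u s)"
      using indS s finU frac_nonedge[OF fx] unfolding indep_def
      by (intro sum.mono_neutral_right) auto
    also have "\<dots> = (\<Sum>u\<in>U - S. if x u s = 1 then 1 else 0)"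
      using int_01[OF fx int] by (intro sum.cong) force+
    also have "\<dots> = real (card {u\<in>U - S. x u s = 1})"
      using finU by (simp add: sum.If_cases Int_def)
    finally have 1: "real (card {u\<in>U - S. x u s = 1}) = pot x U s - outw x s" by simp
    have "finite (T' s)" unfolding T'_def K using finU by auto
    then have "card {u\<in>U - S. x u s = 1} - card (T' s) \<le> card (F s)"
      unfolding F_def by (rule diff_card_le_card_Diff)
    then have "card {u\<in>U - S. x u s = 1} \<le> card (F s) + 3 * (r - 1)"
      using tight[OF s] unfolding T'_def by linarith
    then have "pot x U s - outw x s \<le> real (card (F s)) + 3 * real r - 3"
      unfolding 1[symmetric] using r1 by linarith
    moreover have "outw x s \<le> real k" using outk s SU by blast
    moreover have "real k + 3 * real r + 3 \<le> real X" using room by linarith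
    ultimately have "6 + e s \<le> real (card (F s))" unfolding e_def by linarith
    then show "4 * e s \<le> real (card (F s))" "0 < real (card (F s))" using e[OF s] by linarith+
  qed
  have q: "0 \<le> q s u" "q s u \<le> 1 / 4" if "s \<in> S" for s u
    using e[OF that] cardF[OF that] unfolding q_def by (auto simp: field_simps)
  have qx: "q s u \<le> x u s" if "s \<in> S" for s u
  proof (cases "u \<in> F s")
    case True
    then have "x u s = 1" unfolding F_def by auto
    then show ?thesis using q(2)[OF that, of u] by simp
  next
    case False
    then show ?thesis using frac_nonneg[OF fx] unfolding q_def by simp
  qed
  have sum_q: "(\<Sum>u\<in>U - S. q s u) = e s" if s: "s \<in> S" for s
  proof -
    have "(\<Sum>u\<in>U - S. q s u) = (\<Sum>u\<in>F s. e s / real (card (F s)))"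
      unfolding q_def using finU by (intro sum.mono_neutral_cong_right) (auto simp: F_def)
    then show ?thesis using cardF(2)[OF s] by simp
  qed
  define z where "z u v = (if u \<in> S \<and> v \<in> U - S then (if E u v then 1 else 0) - q u v
     else if v \<in> S \<and> u \<in> U - S then q v u else x u v)" for u v
  have q1: "q s u \<le> (if E s u then 1 else 0)" if "s \<in> S" for s u
    using qx[OF that, of u] frac_le_1[OF fx, of u s] frac_nonedge[OF fx, of u s] E_commute[of u s] by auto
  have fz: "fractional z"
    unfolding fractional_def
  proof (intro allI conjI)
    fix u v
    show "0 \<le> z u v" unfolding z_def using frac_nonneg[OF fx] q q1[of u v] by auto
    show "z u v + z v u = (if E u v then 1 else 0)"
      using fx E_commute[of u v] unfolding z_def fractional_def by auto
  qed
  have z_out: "outw z s = real X" if s: "s \<in> S" for s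
  proof -
    have split: "outw z s = (\<Sum>u\<in>V - U. z s u) + (\<Sum>u\<in>U. z s u)"
      unfolding outw_def using sum.subset_diff[OF UV finV] by simp
    have "(\<Sum>u\<in>V - U. z s u) = (\<Sum>u\<in>V - U. x s u)"
      using s SU unfolding z_def by (intro sum.cong) auto
    moreover have "(\<Sum>u\<in>U. z s u) = (\<Sum>u\<in>U - S. z s u)"
      using indS s finU frac_nonedge[OF fz] unfolding indep_def
      by (intro sum.mono_neutral_right) auto
    moreover have "(\<Sum>u\<in>U - S. z s u) = (\<Sum>u\<in>U - S. if E s u then 1 else 0) - e s"
      unfolding sum_q[OF s, symmetric] sum_subtractf[symmetric]
      using s unfolding z_def by (intro sum.cong) auto
    moreover have "(\<Sum>u\<in>U - S. if E s u then 1 else 0 :: real) = real (card {u\<in>U. E s u})"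
    proof -
      have "{u\<in>U - S. E s u} = {u\<in>U. E s u}" using indS s unfolding indep_def by auto
      then show ?thesis using sum_indicator_E[of "U - S" s] finU by simp
    qed
    ultimately show ?thesis using split unfolding e_def pot_def by simp
  qed
  define M where "M u v \<longleftrightarrow> E u v \<and> (u \<in> S \<and> v \<in> U - S \<or> v \<in> S \<and> u \<in> U - S)" for u v
  have sumS: "(\<Sum>u | u \<in> V \<and> M s u. f s u) = (\<Sum>u\<in>U - S. f s u)" if "fractional f" "s \<in> S" for f s
    by (rule sum_neighbours[OF that(1)]) (use that(2) UV in \<open>auto simp: M_def\<close>)
  have sumU: "(\<Sum>s | s \<in> V \<and> M u s. f u s) = (\<Sum>s\<in>S. f u s)" if "fractional f" "u \<in> U - S" for f u
    by (rule sum_neighbours[OF that(1)]) (use that(2) UV SU in \<open>auto simp: M_def\<close>)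
  have sumV: "(\<Sum>s | s \<in> V \<and> M u s. f u s) = 0" if "u \<notin> U" for f :: "'a \<Rightarrow> 'a \<Rightarrow> real" and u
    using that SU unfolding M_def by (intro sum.neutral) auto
  \<comment> \<open>\<open>L u\<close>: the most that \<open>u\<close> may pay to \<open>S\<close>, an integer.\<close>
  define L where "L u = min (\<Sum>s\<in>S. x u s)
      (if u \<in> K then real (card {s\<in>S. E s u}) - real (w u) else real (card {s\<in>S. E s u}))" for u
  have load: "(\<Sum>s\<in>S. q s u) \<le> L u" if u: "u \<in> U - S" for u
  proof -
    have a: "(\<Sum>s\<in>S. q s u) \<le> (\<Sum>s\<in>S. x u s)" by (intro sum_mono qx)
    have "(\<Sum>s\<in>S. q s u) \<le> (\<Sum>s\<in>S. (1 / 4) * (if E u s then 1 else 0))"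
    proof (rule sum_mono)
      fix s assume s: "s \<in> S"
      show "q s u \<le> (1 / 4) * (if E u s then 1 else 0)"
        using q[OF s, of u] q1[OF s, of u] E_commute[of u s] by (cases "E s u") auto
    qed
    also have "\<dots> = real (card {s\<in>S. E u s}) / 4"
      unfolding sum_distrib_left[symmetric] sum_indicator_E[OF finS] by simp
    also have "{s\<in>S. E u s} = {s\<in>S. E s u}" using E_sym by blast
    finally have b: "(\<Sum>s\<in>S. q s u) \<le> real (card {s\<in>S. E s u}) / 4" .
    have "(\<Sum>s\<in>S. q s u) \<le> real (card {s\<in>S. E s u}) - real (w u)" if uK: "u \<in> K"
    proof (cases "card {s\<in>S. E s u} = w u")
      case True
      have "q s u = 0" if "s \<in> S" for s
      proof (cases "E s u")
        case True
        then show ?thesis using \<open>card {s\<in>S. E s u} = w u\<close> u uK unfolding q_def F_def T'_def by auto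
      next
        case False
        then show ?thesis using q1[OF that, of u] q(1)[OF that, of u] by simp
      qed
      then show ?thesis using True by simp
    next
      case False
      then have "w u + 1 \<le> card {s\<in>S. E s u}" using dw[of u] u uK by auto
      then have "real (w u) + 1 \<le> real (card {s\<in>S. E s u})" by linarith
      moreover have "real (w u) \<le> 3" using w3[OF uK] by simp
      ultimately show ?thesis using b by linarith
    qed
    then show ?thesis using a b unfolding L_def by auto
  qed
  have L_int: "L u \<in> \<int>" for u
    unfolding L_def min_def using int by auto
  define g where "g v = (if v \<in> S then \<Sum>u\<in>U - S. z v u else if v \<in> U then L v else 0)" for v
  have g_int: "g v \<in> \<int>" for v
  proof (cases "v \<in> S")
    case True
    have "outw z v = (\<Sum>u\<in>V - (U - S). z v u) + (\<Sum>u\<in>U - S. z v u)"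
      unfolding outw_def using UV by (subst sum.subset_diff[OF _ finV, of "U - S"]) auto
    moreover have "(\<Sum>u\<in>V - (U - S). z v u) = (\<Sum>u\<in>V - (U - S). x v u)"
      using True unfolding z_def by (intro sum.cong) auto
    moreover have "(\<Sum>u\<in>V - (U - S). x v u) \<in> \<int>" using int by auto
    ultimately have "real X - (\<Sum>u\<in>U - S. z v u) \<in> \<int>"
      using z_out[OF True] by (metis add_diff_cancel_right')
    then have "real X - (real X - (\<Sum>u\<in>U - S. z v u)) \<in> \<int>" by (intro Ints_diff) auto
    then show ?thesis using True unfolding g_def by simp
  qed (auto simp: g_def L_int)
  have g0: "0 \<le> g v" if "v \<in> V" for v
    using load[of v] q frac_nonneg[OF fz] sum_nonneg[of S "\<lambda>s. q s v"] unfolding g_def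
    by (auto intro!: sum_nonneg)
  \<comment> \<open>\<open>g\<close> is integral and nonnegative on \<open>V\<close>, so taking the floor changes nothing.\<close>
  define cap where "cap v = nat \<lfloor>g v\<rfloor>" for v
  have cap: "real (cap v) = g v" if "v \<in> V" for v
    using g0[OF that] g_int[of v] unfolding cap_def by (auto elim: Ints_cases)
  have "\<exists>y. fractional y \<and> (\<forall>u v. \<not> M u v \<longrightarrow> y u v = z u v) \<and> (\<forall>u v. M u v \<longrightarrow> y u v \<in> \<int>)
    \<and> (\<forall>v\<in>V. (\<Sum>u | u \<in> V \<and> M v u. y v u) \<le> real (cap v))
    \<and> (\<forall>v\<in>S. (\<Sum>u | u \<in> V \<and> M v u. y v u) = real (cap v))"
  proof (rule rounding[OF _ _ fz])
    show "E u v" if "M u v" for u v using that unfolding M_def by blast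
    show "M v u" if "M u v" for u v using that E_sym unfolding M_def by blast
    show "S \<subseteq> V" using SU UV by blast
    show eq: "(\<Sum>u | u \<in> V \<and> M v u. z v u) = real (cap v)" if "v \<in> S" for v
      using that SU UV cap[of v] sumS[OF fz that] unfolding g_def by auto
    show "(\<Sum>u | u \<in> V \<and> M v u. z v u) \<le> real (cap v)" if v: "v \<in> V" for v
    proof -
      consider "v \<in> S" | "v \<in> U - S" | "v \<notin> U" by blast
      then show ?thesis
      proof cases
        case 1
        then show ?thesis using eq by simp
      next
        case 2
        have "(\<Sum>s\<in>S. z v s) = (\<Sum>s\<in>S. q s v)"
          using 2 unfolding z_def by (intro sum.cong) auto
        then show ?thesis using load[OF 2] 2 cap[OF v] sumU[OF fz 2] unfolding g_def by auto
      next
        case 3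
        then show ?thesis using sumV[OF 3] by simp
      qed
    qed
  qed
  then obtain y where fy: "fractional y" and off: "\<And>u v. \<not> M u v \<Longrightarrow> y u v = z u v"
    and yint: "\<And>u v. M u v \<Longrightarrow> y u v \<in> \<int>"
    and le: "\<And>v. v \<in> V \<Longrightarrow> (\<Sum>u | u \<in> V \<and> M v u. y v u) \<le> real (cap v)"
    and eq: "\<And>v. v \<in> S \<Longrightarrow> (\<Sum>u | u \<in> V \<and> M v u. y v u) = real (cap v)" by blast
  have yL: "(\<Sum>s\<in>S. y u s) \<le> L u" if u: "u \<in> U - S" for u
    using le[of u] cap[of u] u UV sumU[OF fy u] unfolding g_def by auto
  have "outw y s = real X" if s: "s \<in> S" for s
  proof -
    have split: "outw f s = (\<Sum>u\<in>V - (U - S). f s u) + (\<Sum>u\<in>U - S. f s u)" for f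
      unfolding outw_def using UV by (subst sum.subset_diff[OF _ finV, of "U - S"]) auto
    have "(\<Sum>u\<in>V - (U - S). y s u) = (\<Sum>u\<in>V - (U - S). z s u)"
      using s by (intro sum.cong refl off) (auto simp: M_def)
    moreover have "(\<Sum>u\<in>U - S. y s u) = (\<Sum>u\<in>U - S. z s u)"
      using eq[OF s] sumS[OF fy s] cap[of s] s SU UV unfolding g_def by auto
    ultimately show ?thesis using split[of y] split[of z] z_out[OF s] by simp
  qed
  moreover have "y u v = x u v" if "\<not> (u \<in> S \<and> v \<in> U - S)" "\<not> (v \<in> S \<and> u \<in> U - S)" for u v
    using off[of u v] that unfolding M_def z_def by auto
  moreover have "(\<Sum>s\<in>S. y u s) \<le> (\<Sum>s\<in>S. x u s)" if "u \<in> U - S" for u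
    using yL[OF that] unfolding L_def by auto
  moreover have "(\<Sum>s\<in>S. y u s) \<le> real (card {s\<in>S. E s u}) - real (w u)" if "u \<in> K - S" for u
    using yL[of u] that unfolding L_def K by auto
  moreover have "y u v \<in> \<int>" for u v
  proof (cases "M u v")
    case False
    then show ?thesis
      using off[OF False] int[of u v] frac_nonedge[OF fy, of u v] unfolding M_def z_def by (cases "E u v") auto
  qed (rule yint)
  ultimately show ?thesis using fy by blast
qed

text \<open>The weight of a vertex of the class \<open>i\<close> is the number of edges it has to be relieved of to
  get below the level.  All others have to be relieved of one edge, in order to keep their
  distance to the level.\<close>

lemma sweep:
  assumes st: "state (Suc X) T x U h" and XT: "X \<le> T" and int: "\<And>u v. x u v \<in> \<int>"
    and room: "k + 3 * r + 3 \<le> X" and bound: "\<And>u. u \<in> U \<Longrightarrow> pot x U u \<le> real X + 2"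
  shows "\<exists>y U' h'. state X T y U' h' \<and> U' \<subseteq> U \<and> (\<forall>u v. y u v \<in> \<int>) \<and>
    (\<forall>u\<in>U'. pot y U' u \<le> pot x U u \<and>
      (pot x U u < real X \<or> pot y U' u \<le> pot x U u - 1 \<and> (c u = i \<longrightarrow> pot y U' u \<le> real X - 1)))"
proof -
  have UV: "U \<subseteq> V" and fx: "fractional x" using st unfolding state_def by auto
  define K where "K = {u\<in>U. real X \<le> pot x U u}"
  define w where "w v = (if c v = i then nat \<lfloor>pot x U v - real X\<rfloor> + 1 else 1)" for v
  have KV: "K \<subseteq> V" using UV unfolding K_def by auto
  obtain S where S: "S \<subseteq> K" "indep S"
    and swap: "\<And>Q. Q \<subseteq> K - S \<Longrightarrow> indep Q \<Longrightarrow> sum w Q \<le> sum w {s\<in>S. \<exists>q\<in>Q. E s q}"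
    using max_weight_indep[OF KV, of w] by blast
  have SU: "S \<subseteq> U" using S(1) unfolding K_def by auto
  have finS: "finite S" by (rule finite_sub) (use SU UV in blast)
  have w1: "w v = 1" if "c v \<noteq> i" for v using that unfolding w_def by simp
  have wi: "real (w v) = pot x U v - real X + 1" if "c v = i" "v \<in> K" for v
  proof -
    obtain n where n: "pot x U v = of_int n"
      using pot_outw_Ints(1)[OF fx int, of U v] by (elim Ints_cases)
    then have "\<lfloor>pot x U v - real X\<rfloor> = n - int X" by linarith
    moreover have "int X \<le> n" using that(2) n unfolding K_def by simp
    ultimately show ?thesis using that(1) n unfolding w_def by simp
  qed
  have w13: "1 \<le> w v \<and> w v \<le> 3" if "v \<in> K" for v
  proof (cases "c v = i")
    case True
    have "real X \<le> pot x U v" "pot x U v \<le> real X + 2"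
      using that bound unfolding K_def by auto
    then show ?thesis using wi[OF True that] by linarith
  qed (simp add: w1)
  have dw: "w v \<le> card {s\<in>S. E s v}" if "v \<in> K - S" for v
    by (rule tight_neighbours(1)[OF KV S swap w1 w13 that])
  have tight: "card {u\<in>K - S. E s u \<and> card {s'\<in>S. E s' u} = w u} \<le> 3 * (r - 1)" if "s \<in> S" for s
    by (rule tight_neighbours(2)[OF KV S swap w1 w13 that])
  have w3: "w v \<le> 3" if "v \<in> K" for v using w13[OF that] by simp
  from sweep_payments[OF st int room bound K_def S w3 dw tight]
  obtain y where fy: "fractional y"
    and agree: "\<And>u v. \<not> (u \<in> S \<and> v \<in> U - S) \<Longrightarrow> \<not> (v \<in> S \<and> u \<in> U - S) \<Longrightarrow> y u v = x u v"
    and outS: "\<And>s. s \<in> S \<Longrightarrow> outw y s = real X"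
    and less: "\<And>u. u \<in> U - S \<Longrightarrow> (\<Sum>s\<in>S. y u s) \<le> (\<Sum>s\<in>S. x u s)"
    and paid: "\<And>u. u \<in> K - S \<Longrightarrow> (\<Sum>s\<in>S. y u s) \<le> real (card {s\<in>S. E s u}) - real (w u)"
    and yint: "\<forall>u v. y u v \<in> \<int>"
    by auto
  note peel = state_peel[OF st XT SU S(2) fy agree outS less]
  have drop: "pot y (U - S) u = pot x U u - (\<Sum>s\<in>S. y s u)" if "u \<in> U - S" for u
    by (rule peel(2)) (use that in auto)
  have "pot y (U - S) u \<le> pot x U u" if "u \<in> U - S" for u
    using drop[OF that] frac_nonneg[OF fy] by (simp add: sum_nonneg)
  moreover have "pot y (U - S) u \<le> pot x U u - 1 \<and> (c u = i \<longrightarrow> pot y (U - S) u \<le> real X - 1)"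
    if u: "u \<in> U - S" "\<not> pot x U u < real X" for u
  proof -
    have uK: "u \<in> K - S" using u unfolding K_def by auto
    have "real (card {s\<in>S. E u s}) = (\<Sum>s\<in>S. y u s + y s u)"
      unfolding sum_indicator_E[OF finS, symmetric]
      using fy by (intro sum.cong) (auto simp: fractional_def)
    moreover have "{s\<in>S. E u s} = {s\<in>S. E s u}" using E_sym by blast
    ultimately have "real (w u) \<le> (\<Sum>s\<in>S. y s u)" using paid[OF uK] by (simp add: sum.distrib)
    then have le: "pot y (U - S) u \<le> pot x U u - real (w u)" using drop[OF u(1)] by simp
    then show ?thesis using w13[of u] wi[of u] uK by auto
  qed
  moreover have "state X T y (U - S) (\<lambda>v. if v \<in> S then X else h v)"
    by (rule peel(1)) auto
  ultimately show ?thesis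
    using yint by (intro exI[of _ y] exI[of _ "U - S"] exI[of _ "\<lambda>v. if v \<in> S then X else h v"]) blast
qed

text \<open>The level \<open>X - j\<close> serves the class \<open>j\<close>; afterwards this class stays at or below the level,
  since a vertex that reaches the level loses at least \<open>1\<close>, and potentials are integers.\<close>

lemma sweep_all_classes:
  assumes st: "state (Suc X) T x U h" and XT: "X \<le> T" and int: "\<And>u v. x u v \<in> \<int>"
    and room: "k + 4 * r + 3 \<le> Suc X" and bound: "\<And>u. u \<in> U \<Longrightarrow> pot x U u \<le> real X + 2"
    and i: "i \<le> r"
  shows "\<exists>y U' h'. state (Suc (X - i)) T y U' h' \<and> (\<forall>u v. y u v \<in> \<int>) \<and>
    (\<forall>u\<in>U'. pot y U' u \<le> real (X - i) + 2 \<and> (c u < i \<longrightarrow> pot y U' u \<le> real (X - i)))"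
  using i
proof (induction i)
  case 0
  show ?case using st int bound by (intro exI[of _ x] exI[of _ U] exI[of _ h]) simp
next
  case (Suc i)
  then obtain y U' h' where st': "state (Suc (X - i)) T y U' h'" and int': "\<And>u v. y u v \<in> \<int>"
    and b: "\<And>u. u \<in> U' \<Longrightarrow> pot y U' u \<le> real (X - i) + 2"
      "\<And>u. u \<in> U' \<Longrightarrow> c u < i \<Longrightarrow> pot y U' u \<le> real (X - i)" by force
  have fy: "fractional y" using st' unfolding state_def by blast
  define Z where "Z = X - i"
  have Z: "Z \<le> T" "k + 3 * r + 3 \<le> Z" "Suc (X - Suc i) = Z"
    using Suc.prems XT room unfolding Z_def by linarith+
  then have realZ: "real (X - Suc i) = real Z - 1" by linarith
  obtain y' U'' h'' where st'': "state Z T y' U'' h''" and sub: "U'' \<subseteq> U'" and int'': "\<forall>u v. y' u v \<in> \<int>"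
    and step: "\<And>u. u \<in> U'' \<Longrightarrow> pot y' U'' u \<le> pot y U' u"
      "\<And>u. u \<in> U'' \<Longrightarrow> pot y U' u < real Z \<or>
        pot y' U'' u \<le> pot y U' u - 1 \<and> (c u = i \<longrightarrow> pot y' U'' u \<le> real Z - 1)"
    using sweep[OF st'[folded Z_def] Z(1) int' Z(2) b(1)[folded Z_def], where i = i] by blast
  have "pot y' U'' u \<le> real Z - 1 + 2 \<and> (c u < Suc i \<longrightarrow> pot y' U'' u \<le> real Z - 1)" if u: "u \<in> U''" for u
  proof (cases "pot y U' u < real Z")
    case True
    then have "pot y U' u \<le> real Z - 1"
      by (intro Ints_less_of_nat pot_outw_Ints(1)[OF fy int'])
    then show ?thesis using step(1)[OF u] by linarith
  next
    case False
    then show ?thesis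
      using step(2)[OF u] b[of u] u sub unfolding Z_def[symmetric] by (auto simp: less_Suc_eq)
  qed
  then show ?case using st'' int'' unfolding Z(3) realZ by blast
qed

section \<open>Deciding all remaining vertices\<close>

text \<open>When no potential exceeds the level, the members of \<open>S\<close> can take the fraction \<open>1\<close>.\<close>

lemma greedy_level:
  assumes st: "state (Suc X) T x U h" and XT: "X \<le> T"
    and int: "\<forall>u v. x u v \<in> \<int>" and bound: "\<forall>u\<in>U. pot x U u \<le> real X"
  shows "\<exists>y U' h'. state X T y U' h' \<and> U' \<subseteq> U \<and> (\<forall>u v. y u v \<in> \<int>) \<and>
    (\<forall>u\<in>U'. pot y U' u \<le> pot x U u) \<and>
    (\<forall>u\<in>U'. pot x U u < real X \<or> pot y U' u \<le> pot x U u - 1)"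
proof -
  have fx: "fractional x" and UV: "U \<subseteq> V" using st unfolding state_def by auto
  have "outw x s \<le> real X" if "s \<in> U" for s
    using outw_le_pot[OF fx UV, of s] bound that by fastforce
  then have o: "\<And>s. s \<in> U \<Longrightarrow> real X \<le> pot x U s \<Longrightarrow> outw x s \<le> real X" by blast
  have p: "\<And>s. s \<in> U \<Longrightarrow> real X \<le> pot x U s \<Longrightarrow> 1 * (pot x U s - real k) \<le> real X - real k"
    using bound by simp
  obtain y U' h' where y: "state X T y U' h'" "U' \<subseteq> U"
    "\<forall>u\<in>U'. pot y U' u \<le> pot x U u \<and>
       (pot x U u < real X \<or> c u \<noteq> 0 \<and> pot y U' u \<le> pot x U u - 1)"
    "(\<forall>u\<in>U. pot x U u \<le> real X) \<longrightarrow> (\<forall>u v. x u v \<in> \<int>) \<longrightarrow> (\<forall>u v. y u v \<in> \<int>)"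
    using fractional_level[OF st XT o zero_le_one order_refl p, of 0] by blast
  have "\<forall>u v. y u v \<in> \<int>" using y(4) bound int by blast
  moreover have "(\<forall>u\<in>U'. pot y U' u \<le> pot x U u) \<and>
    (\<forall>u\<in>U'. pot x U u < real X \<or> pot y U' u \<le> pot x U u - 1)" using y(3) by blast
  ultimately show ?thesis using y(1,2) by blast
qed

text \<open>At level \<open>0\<close> an undecided vertex would have to end with a negative potential, so there is none
  left.\<close>

lemma greedy_levels:
  assumes "state (Suc X) T x U h" "X \<le> T" "\<forall>u v. x u v \<in> \<int>" "\<forall>u\<in>U. pot x U u \<le> real X"
  shows "\<exists>y h'. state 0 T y {} h' \<and> (\<forall>u v. y u v \<in> \<int>)"
  using assms
proof (induction X arbitrary: x U h)
  case (0 x U h)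
  obtain y U' h' where y: "state 0 T y U' h'" "U' \<subseteq> U" "\<forall>u v. y u v \<in> \<int>"
    "\<forall>u\<in>U'. pot x U u < real 0 \<or> pot y U' u \<le> pot x U u - 1"
    using greedy_level[OF 0] by blast
  have fy: "fractional y" and fx: "fractional x" using y(1) 0(1) unfolding state_def by auto
  have pos: "0 \<le> pot y U' u" "0 \<le> pot x U u" for u
    unfolding pot_def using frac_nonneg[OF fy] frac_nonneg[OF fx] by (simp_all add: sum_nonneg)
  have "U' = {}"
  proof (rule ccontr)
    assume "U' \<noteq> {}"
    then obtain u where u: "u \<in> U'" by blast
    then have "u \<in> U" using y(2) by blast
    then have "pot x U u \<le> real 0" using 0(4) by blast
    then show False using y(4) pos[of u] u by fastforce
  qed
  then show ?case using y(1,3) by blast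
next
  case (Suc X x U h)
  have fx: "fractional x" using Suc.prems(1) unfolding state_def by auto
  obtain y U' h' where y: "state (Suc X) T y U' h'" "U' \<subseteq> U" "\<forall>u v. y u v \<in> \<int>"
    "\<forall>u\<in>U'. pot y U' u \<le> pot x U u" "\<forall>u\<in>U'. pot x U u < real (Suc X) \<or> pot y U' u \<le> pot x U u - 1"
    using greedy_level[OF Suc.prems] by blast
  have "pot y U' u \<le> real X" if u: "u \<in> U'" for u
  proof (cases "pot x U u < real (Suc X)")
    case True
    have "pot x U u \<in> \<int>" by (rule pot_outw_Ints(1)[OF fx]) (use Suc.prems(3) in blast)
    then have "pot x U u \<le> real (Suc X) - 1" using True by (rule Ints_less_of_nat)
    moreover have "pot y U' u \<le> pot x U u" using y(4) u by blast
    ultimately show ?thesis by simp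
  next
    case False
    then have "pot y U' u \<le> pot x U u - 1" using y(5) u by blast
    moreover have "pot x U u \<le> real (Suc X)" using Suc.prems(4) u y(2) by blast
    ultimately show ?thesis by simp
  qed
  then show ?case using Suc.IH[OF y(1)] y(3) Suc.prems(2) by simp
qed

lemma completion:
  assumes st: "state (Suc X) T x U h" and XT: "X \<le> T" and room: "k + 4 * r + 3 \<le> Suc X"
    and bound: "\<And>u. u \<in> U \<Longrightarrow> pot x U u < real X + 2"
  shows "\<exists>y h'. state 0 T y {} h' \<and> (\<forall>u v. y u v \<in> \<int>)"
proof -
  obtain y where y: "state (Suc X) T y U h" "\<And>u v. y u v \<in> \<int>" "\<And>u. u \<in> U \<Longrightarrow> pot y U u \<le> real X + 2"
    using integralise[OF st bound] by blast
  obtain z U' h' where z: "state (Suc (X - r)) T z U' h'" "\<And>u v. z u v \<in> \<int>"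
    "\<And>u. u \<in> U' \<Longrightarrow> c u < r \<Longrightarrow> pot z U' u \<le> real (X - r)"
    using sweep_all_classes[OF y(1) XT y(2) room y(3) order_refl] by blast
  have "\<forall>u\<in>U'. pot z U' u \<le> real (X - r)"
    using z(1,3) c_less unfolding state_def by blast
  then show ?thesis using greedy_levels[OF z(1)] z(2) XT by simp
qed

text \<open>The levels are spent as follows: \<open>r\<close> for the first phase, \<open>t r\<close> for the others (if \<open>t \<ge> 2\<close>), \<open>r\<close> for
  the sweeps, and the rest for the greedy part.  The phases use up \<open>r (t + 1)\<close> levels and need a level that stays
  \<open>2 r (t + 1)\<close> above \<open>k\<close>, which is where the factor \<open>3\<close> comes from.\<close>

lemma bounded_proper_orientation:
  assumes sparse: "\<And>J. J \<subseteq> {{u, v} |u v. E u v} \<Longrightarrow> card J \<le> k * card (\<Union>J)"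
    and r: "2 \<le> r" and t: "1 \<le> t" and rt: "r - 1 \<le> t ^ (t + 1)"
    and T: "T = k + 3 * r * (t + 1)"
  shows "\<exists>y h. state 0 T y {} h \<and> (\<forall>u v. y u v \<in> \<int>)"
proof -
  obtain x0 where x0: "state (Suc T) T x0 V (\<lambda>_. 0)"
    using initial_state[OF sparse] by blast
  have rT: "3 * r + 3 * r * t = T - k" "k \<le> T" unfolding T by (simp_all add: algebra_simps)
  have rt_ge: "r * 1 \<le> r * t" using t by (intro mult_le_mono2)
  have "\<exists>x U h. state (Suc (T - r)) T x U h \<and>
    (\<forall>u\<in>U. pot x U u < real (T - r) + (1 + (real r - 1) * 1))"
  \<comment> \<open>For \<open>d = 1\<close> nothing is required of the initial excess, and \<open>card V + 1\<close> bounds it trivially.\<close>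
  proof (rule phase[OF x0 order_refl, where Y = 0 and B = "real (card V) + 1"])
    show "k + 0 + r \<le> Suc T" "r \<le> T" using rT by linarith+
    show "pot x0 V u < real T + (real (card V) + 1)" for u
    proof -
      have "card {v\<in>V. E u v} \<le> card V" using finV by (intro card_mono) auto
      then show ?thesis unfolding pot_def by simp
    qed
  qed auto
  then obtain x1 U1 h1 where x1: "state (Suc (T - r)) T x1 U1 h1"
    "\<And>u. u \<in> U1 \<Longrightarrow> pot x1 U1 u < real (T - r) + real r" by auto
  show ?thesis
  proof (cases "t = 1")
    case True
    then have r2: "r = 2" using r rt by simp
    show ?thesis
      by (rule completion[OF x1(1)]) (use x1(2) True r2 in \<open>auto simp: T\<close>)
  next
    case False
    then have t2: "2 \<le> t" using t by simp
    define q where "q = 2 * real t + 1"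
    have q: "q / (q - 1) = 1 + 1 / (2 * real t)" unfolding q_def using t by (simp add: field_simps)
    have "\<exists>x U h. state (Suc (T - r - t * r)) T x U h \<and>
      (\<forall>u\<in>U. pot x U u < real (T - r - t * r) + (real r / q ^ t + q / (q - 1)))"
      unfolding q_def
    proof (rule phases[OF x1(1)])
      show "T - r \<le> T" by simp
      show "k + 2 * r * (t + 1) + t * r \<le> Suc (T - r)"
        unfolding T by (simp add: algebra_simps)
      show "1 \<le> r" "1 \<le> t" using r t by auto
      show "pot x1 U1 u < real (T - r) + (real r + (2 * real t + 1) / (2 * real t + 1 - 1))" if "u \<in> U1" for u
        using x1(2)[OF that] by (smt (verit) divide_nonneg_nonneg of_nat_0_le_iff)
    qed
    then obtain x2 U2 h2 where x2: "state (Suc (T - r - t * r)) T x2 U2 h2"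
      "\<And>u. u \<in> U2 \<Longrightarrow> pot x2 U2 u < real (T - r - t * r) + (real r / q ^ t + q / (q - 1))" by blast
    \<comment> \<open>The first summand is at most \<open>3 / 4\<close> and the second is \<open>1 + 1 / (2 t) \<le> 5 / 4\<close>.\<close>
    have "real r / q ^ t + q / (q - 1) \<le> 2"
    proof -
      have two: "2 * t \<le> 2 ^ t" using t2
      proof (induction t rule: dec_induct)
        case (step n)
        then show ?case by simp
      qed simp
      have "8 \<le> t ^ (t + 1)"
        using power_mono[OF t2, of 3] power_increasing[of 3 "t + 1" t] t2 by simp
      then have "2 * r \<le> 3 * t ^ (t + 1)" using rt by linarith
      also have "3 * t ^ (t + 1) * 2 = 3 * (2 * t) * t ^ t" by simp
      finally have "2 * r * 2 \<le> 3 * (2 * t) * t ^ t" by simp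
      also have "\<dots> \<le> 3 * 2 ^ t * t ^ t" using two by simp
      also have "\<dots> = 3 * (2 * t) ^ t" by (simp add: power_mult_distrib)
      finally have "real (2 * r * 2) \<le> real (3 * (2 * t) ^ t)" by (rule of_nat_mono)
      then have "4 * real r \<le> 3 * (2 * real t) ^ t" by simp
      also have "\<dots> \<le> 3 * q ^ t" unfolding q_def by (intro mult_left_mono power_mono) auto
      finally have "real r / q ^ t \<le> 3 / 4" unfolding q_def by (simp add: divide_le_eq)
      moreover have "1 / (2 * real t) \<le> 1 / 4" using t2 by (simp add: field_simps)
      ultimately show ?thesis unfolding q by linarith
    qed
    then have bound: "pot x2 U2 u < real (T - r - t * r) + 2" if "u \<in> U2" for u
      using x2(2)[OF that] by linarith
    have rt2: "r * 2 \<le> r * t" using t2 by (intro mult_le_mono2)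
    show ?thesis
    proof (rule completion[OF x2(1) _ _ bound])
      show "T - r - t * r \<le> T" by simp
      have "T - r - t * r = k + 2 * r + 2 * (r * t)" unfolding T by (simp add: algebra_simps)
      then show "k + 4 * r + 3 \<le> Suc (T - r - t * r)" using rt2 r by linarith
    qed
  qed
qed

end

section \<open>The bound for graphs\<close>

text \<open>Apply the bound to the subgraph that consists of the edges \<open>J\<close> and their ends.\<close>

lemma mad_sparse:
  assumes G: "simple_graph G" and mad: "mad G \<le> 2 * real k" and J: "J \<subseteq> edges G"
  shows "card J \<le> k * card (\<Union>J)"
proof (cases "J = {}")
  case False
  let ?val = "\<lambda>(A, B). 2 * real (card B) / real (card A)"
  let ?S = "{2 * real (card (edges H)) / real (card (verts H)) | H. is_subgraph H G \<and> verts H \<noteq> {}}"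
  have fin: "finite (verts G)" and e: "\<And>e. e \<in> edges G \<Longrightarrow> e \<subseteq> verts G \<and> card e = 2"
    using G unfolding simple_graph_def by auto
  have "edges G \<subseteq> Pow (verts G)" using e by auto
  then have "finite (edges G)" using fin by (simp add: finite_subset)
  moreover have "?S \<subseteq> ?val ` (Pow (verts G) \<times> Pow (edges G))"
    unfolding is_subgraph_def by force
  ultimately have finS: "finite ?S" using fin by (elim finite_subset) auto
  have sub: "\<Union>J \<subseteq> verts G" using J e by blast
  then have finU: "finite (\<Union>J)" using fin by (rule finite_subset)
  obtain a where a: "a \<in> J" using False by blast
  then have "card a = 2" using J e by blast
  then have "a \<noteq> {}" by auto
  then have ne: "\<Union>J \<noteq> {}" using a by blast
  have "2 * real (card J) / real (card (\<Union>J)) \<in> ?S"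
    using J e sub finU ne
    by (intro CollectI exI[of _ "\<lparr>verts = \<Union>J, edges = J\<rparr>"]) (auto simp: is_subgraph_def simple_graph_def)
  then have "2 * real (card J) / real (card (\<Union>J)) \<le> mad G"
    unfolding mad_def using finS by (intro Max_ge) auto
  then have "2 * real (card J) / real (card (\<Union>J)) \<le> 2 * real k" using mad by linarith
  moreover have "0 < card (\<Union>J)" using finU ne by (simp add: card_gt_0_iff)
  ultimately have "real (card J) \<le> real k * real (card (\<Union>J))" by (simp add: divide_le_eq)
  then have "real (card J) \<le> real (k * card (\<Union>J))" by simp
  then show ?thesis by (simp only: of_nat_le_iff)
qed simp

lemma partite_colouring:
  assumes "partite r G" "simple_graph G"
  obtains c :: "'a \<Rightarrow> nat" where "coloured_graph (verts G) (\<lambda>u v. {u, v} \<in> edges G) c r"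
proof -
  obtain P where P: "(\<Union>i<r. P i) = verts G" "\<And>i. i < r \<Longrightarrow> independent G (P i)"
    using assms(1) unfolding partite_def by blast
  define c where "c v = (SOME i. i < r \<and> v \<in> P i)" for v
  have c: "c v < r \<and> v \<in> P (c v)" if "v \<in> verts G" for v
  proof -
    have "\<exists>i. i < r \<and> v \<in> P i" using that P(1) by blast
    then show ?thesis unfolding c_def by (rule someI_ex)
  qed
  have E: "u \<in> verts G \<and> v \<in> verts G" if "{u, v} \<in> edges G" for u v
    using that assms(2) unfolding simple_graph_def by blast
  have "coloured_graph (verts G) (\<lambda>u v. {u, v} \<in> edges G) c r"
  proof
    show "finite (verts G)" using assms(2) unfolding simple_graph_def by blast
    show "u \<in> verts G \<and> v \<in> verts G" if "{u, v} \<in> edges G" for u v by (rule E[OF that])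
    show "{v, u} \<in> edges G" if "{u, v} \<in> edges G" for u v using that by (simp add: insert_commute)
    show "c v < r" if "v \<in> verts G" for v using c[OF that] by blast
    show "c u \<noteq> c v" if uv: "{u, v} \<in> edges G" for u v
    proof
      assume "c u = c v"
      then show False
        using c[of u] c[of v] E[OF uv] P(2)[of "c u"] uv unfolding independent_def by auto
    qed
  qed
  then show thesis by (rule that)
qed

lemma proper_orientation_number_le:
  assumes "proper_orientation G D" "max_outdeg G D \<le> m"
  shows "proper_orientation_number G \<le> m"
proof -
  have "proper_orientation_number G \<le> max_outdeg G D"
    unfolding proper_orientation_number_def using assms(1) by (intro Least_le) blast
  then show ?thesis using assms(2) by simp
qed

lemma proper_orientation_bound:
  fixes G :: "'a ugraph"
  assumes r: "2 \<le> r" and t: "1 \<le> t" "r - 1 \<le> t ^ (t + 1)"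
    and G: "simple_graph G" "partite r G" and mad: "mad G \<le> 2 * real k"
  shows "proper_orientation_number G \<le> k + 3 * r * (t + 1)"
proof -
  define T where "T = k + 3 * r * (t + 1)"
  obtain c where c: "coloured_graph (verts G) (\<lambda>u v. {u, v} \<in> edges G) c r"
    using partite_colouring[OF G(2,1)] .
  interpret coloured_graph "verts G" "\<lambda>u v. {u, v} \<in> edges G" c r k by (rule c)
  have "card J \<le> k * card (\<Union>J)" if "J \<subseteq> {{u, v} |u v. {u, v} \<in> edges G}" for J
    using that by (intro mad_sparse[OF G(1) mad]) auto
  then obtain y h where y: "state 0 T y {} h" "\<forall>u v. y u v \<in> \<int>"
    using bounded_proper_orientation[OF _ r t T_def] by blast
  have fy: "fractional y" using y(1) unfolding state_def by blast
  define D where "D = {(u, v). y u v = 1}"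
  have y01: "y u v = 0 \<or> y u v = 1" for u v
    using y(2) fy by (intro int_01) auto
  have "outdeg D v = h v \<and> h v \<le> T" if v: "v \<in> verts G" for v
  proof -
    have "{u. (v, u) \<in> D} = {u\<in>verts G. y v u = 1}"
      unfolding D_def using frac_nonedge[OF fy, of v] E_V by force
    moreover have "outw y v = (\<Sum>u\<in>verts G. if y v u = 1 then 1 else 0)"
      unfolding outw_def using y01 by (intro sum.cong) force+
    then have "outw y v = real (card {u\<in>verts G. y v u = 1})"
      using finV by (simp add: sum.If_cases Int_def)
    moreover have "outw y v = real (h v) \<and> h v \<le> T"
      using y(1) v unfolding state_def by auto
    ultimately show ?thesis unfolding outdeg_def by simp
  qed
  note out = this
  have "{u, v} \<in> edges G" if "y u v = 1" for u v
    using frac_nonedge[OF fy, of u v] that by fastforce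
  moreover have "y u v = 1 \<longleftrightarrow> y v u \<noteq> 1" if "{u, v} \<in> edges G" for u v
    using frac_edge[OF fy that] y01[of u v] y01[of v u] by auto
  ultimately have "orientation G D" unfolding orientation_def D_def by auto
  moreover have "h u \<noteq> h v" if "{u, v} \<in> edges G" for u v
    using y(1) that E_V[OF that] unfolding state_def by blast
  ultimately have "proper_orientation G D"
    unfolding proper_orientation_def using out E_V by metis
  moreover have "max_outdeg G D \<le> T"
    unfolding max_outdeg_def using finV out by auto
  ultimately show ?thesis unfolding T_def by (rule proper_orientation_number_le)
qed

section \<open>The growth of the number of phases\<close>

lemma t_of_props:
  assumes "2 \<le> r"
  shows "1 \<le> t_of r" "r - 1 \<le> t_of r ^ (t_of r + 1)"
proof -
  have "r ^ 1 \<le> r ^ (r + 1)" using assms by (intro power_increasing) auto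
  then have "1 \<le> r \<and> r - 1 \<le> r ^ (r + 1)" using assms unfolding power_one_right by linarith
  from LeastI[where P = "\<lambda>t. 1 \<le> t \<and> r - 1 \<le> t ^ (t + 1)", OF this]
  show "1 \<le> t_of r" "r - 1 \<le> t_of r ^ (t_of r + 1)" unfolding t_of_def by auto
qed

text \<open>The number \<open>t_of r - 1\<close> violates the condition that defines \<open>t_of r\<close>.\<close>

lemma t_of_upper:
  assumes r: "2 \<le> r" and t: "2 \<le> t_of r"
  shows "real (t_of r) * ln (real (t_of r) - 1) \<le> ln (real r)"
proof -
  have "t_of r - 1 < (LEAST t. 1 \<le> t \<and> r - 1 \<le> t ^ (t + 1))"
    using t unfolding t_of_def[symmetric] by linarith
  from not_less_Least[OF this] have "\<not> r - 1 \<le> (t_of r - 1) ^ (t_of r - 1 + 1)" using t by linarith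
  moreover have "t_of r - 1 + 1 = t_of r" using t by linarith
  ultimately have "(t_of r - 1) ^ t_of r \<le> r" by (simp only:)
  then have "real ((t_of r - 1) ^ t_of r) \<le> real r" by (rule of_nat_mono)
  then have le: "(real (t_of r) - 1) ^ t_of r \<le> real r" using t by (simp add: of_nat_diff)
  have pos: "0 < real (t_of r) - 1" using t by simp
  have "real (t_of r) * ln (real (t_of r) - 1) = ln ((real (t_of r) - 1) ^ t_of r)"
    using pos by (simp add: ln_realpow)
  also have "\<dots> \<le> ln (real r)" using le pos by (intro ln_mono) auto
  finally show ?thesis .
qed

text \<open>With \<open>L = ln r\<close> and \<open>b = (1 + d) L / ln L\<close>, the function \<open>(b - 1) ln (b - 2)\<close> grows like \<open>(1 + d) L\<close>
  and eventually exceeds \<open>L\<close>, so \<open>t + 1 > b\<close> would contradict \<open>t ln (t - 1) \<le> L\<close>.\<close>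

lemma t_of_asymp:
  assumes d: "0 < d"
  shows "eventually (\<lambda>r. (real (t_of r) + 1) * ln (ln (real r)) / ln (real r) \<le> 1 + d) sequentially"
proof -
  have "eventually (\<lambda>L::real. L < ((1 + d) * L / ln L - 1) * ln ((1 + d) * L / ln L - 2)) at_top"
    using d by real_asymp
  moreover have "eventually (\<lambda>L::real. 3 \<le> (1 + d) * L / ln L \<and> 1 < L) at_top"
    using d by (intro eventually_conj) real_asymp+
  moreover have "filterlim (\<lambda>r. ln (real r)) at_top sequentially" by real_asymp
  ultimately have "eventually (\<lambda>r. ln (real r) < ((1 + d) * ln (real r) / ln (ln (real r)) - 1) *
        ln ((1 + d) * ln (real r) / ln (ln (real r)) - 2) \<and>
      3 \<le> (1 + d) * ln (real r) / ln (ln (real r)) \<and> 1 < ln (real r)) sequentially"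
    using eventually_compose_filterlim eventually_conj by fast
  then show ?thesis using eventually_ge_at_top[of 2]
  proof eventually_elim
    case (elim r)
    define L where "L = ln (real r)"
    define b where "b = (1 + d) * L / ln L"
    have L: "L < (b - 1) * ln (b - 2)" "3 \<le> b" "1 < L"
      using elim(1) unfolding b_def L_def by auto
    have "real (t_of r) + 1 \<le> b"
    proof (rule ccontr)
      assume "\<not> real (t_of r) + 1 \<le> b"
      then have lt: "b - 1 < real (t_of r)" by simp
      then have "2 \<le> t_of r" using L(2) by linarith
      then have "real (t_of r) * ln (real (t_of r) - 1) \<le> L"
        unfolding L_def by (rule t_of_upper[OF elim(2)])
      moreover have "(b - 1) * ln (b - 2) \<le> real (t_of r) * ln (real (t_of r) - 1)"
        using lt L(2) by (intro mult_mono) auto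
      ultimately show False using L(1) by linarith
    qed
    moreover have "0 < ln L" using L(3) by simp
    ultimately have "(real (t_of r) + 1) * ln L \<le> (1 + d) * L"
      unfolding b_def by (simp add: pos_le_divide_eq)
    then show "(real (t_of r) + 1) * ln (ln (real r)) / ln (real r) \<le> 1 + d"
      using L(3) unfolding L_def by (simp add: pos_divide_le_eq)
  qed
qed

text \<open>Solving the desired inequality, as an equation, for the error term gives \<open>f\<close>.  Cutting off the
  negative values of \<open>f\<close> makes it tend to \<open>0\<close> and only weakens the inequality as long as
  \<open>ln (ln r) > 0\<close>.  For \<open>r = 2\<close> this logarithm is negative, so there \<open>f\<close> itself is used.\<close>

lemma t_of_error_term:
  "\<exists>\<epsilon> :: nat \<Rightarrow> real. \<epsilon> \<longlonglongrightarrow> 0 \<and>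
      (\<forall>(r::nat) (k::nat). r \<ge> 2 \<and> k \<ge> 1 \<longrightarrow>
         real (k + 3 * r * (t_of r + 1))
           \<le> real k + 3 * (1 + \<epsilon> r) * real r * ln (real r) / ln (ln (real r)))"
proof -
  define f where "f r = (real (t_of r) + 1) * ln (ln (real r)) / ln (real r) - 1" for r
  define \<epsilon> where "\<epsilon> r = (if r \<le> 2 then f r else max 0 (f r))" for r
  have lim: "\<epsilon> \<longlonglongrightarrow> 0"
  proof (rule LIMSEQ_I)
    fix d :: real assume d: "0 < d"
    have "eventually (\<lambda>r. f r \<le> d / 2) sequentially"
      using t_of_asymp[of "d / 2"] d unfolding f_def
      by (simp only: diff_le_eq add.commute half_gt_zero)
    then have "eventually (\<lambda>r. norm (\<epsilon> r - 0) < d) sequentially"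
      using eventually_gt_at_top[of 2] by eventually_elim (use d in \<open>auto simp: \<epsilon>_def\<close>)
    then show "\<exists>no. \<forall>n\<ge>no. norm (\<epsilon> n - 0) < d" by (simp add: eventually_sequentially)
  qed
  have "3 * real r * (real (t_of r) + 1) \<le> 3 * (1 + \<epsilon> r) * real r * ln (real r) / ln (ln (real r))"
    if r: "2 \<le> r" for r
  proof -
    have L: "0 < ln (real r)" using r by simp
    \<comment> \<open>No natural number equals \<open>exp 1\<close>, so the denominator \<open>ln (ln r)\<close> is not \<open>0\<close>.\<close>
    have "ln (real r) \<noteq> 1"
    proof (cases "r = 2")
      case True
      then show ?thesis using ln_2_less_1 by simp
    next
      case False
      then have "exp 1 < real r" using r e_less_272 by simp
      moreover have "exp (ln (real r)) = real r" using r by simp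
      ultimately show ?thesis by (metis less_irrefl)
    qed
    then have LL: "ln (ln (real r)) \<noteq> 0" using L by simp
    have eq: "3 * (1 + f r) * real r * ln (real r) / ln (ln (real r)) = 3 * real r * (real (t_of r) + 1)"
      unfolding f_def using L LL by (simp add: field_simps)
    show ?thesis
    proof (cases "r = 2")
      case True
      then show ?thesis using eq by (simp add: \<epsilon>_def)
    next
      case False
      then have "exp 1 < real r" using r e_less_272 by simp
      then have "1 < ln (real r)" using ln_less_cancel_iff[of "exp 1" "real r"] r by simp
      then have "0 < ln (ln (real r))" by simp
      then have "3 * (1 + f r) * real r * ln (real r) / ln (ln (real r))
        \<le> 3 * (1 + \<epsilon> r) * real r * ln (real r) / ln (ln (real r))"
        using L unfolding \<epsilon>_def by (intro divide_right_mono mult_right_mono) auto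
      then show ?thesis using eq by simp
    qed
  qed
  then show ?thesis using lim by (intro exI[of _ \<epsilon>]) (simp add: algebra_simps)
qed

section \<open>The explicit and the asymptotic bound\<close>

theorem theorem5p1:
  "(\<forall>(r::nat) (k::nat) (G :: 'a ugraph).
      r \<ge> 2 \<and> k \<ge> 1 \<and> simple_graph G \<and> partite r G \<and> mad G \<le> 2 * real k \<longrightarrow>
      proper_orientation_number G \<le> k + 3 * r * (t_of r + 1)) \<and>
   (\<exists>\<epsilon> :: nat \<Rightarrow> real. \<epsilon> \<longlonglongrightarrow> 0 \<and>
      (\<forall>(r::nat) (k::nat). r \<ge> 2 \<and> k \<ge> 1 \<longrightarrow>
         real (k + 3 * r * (t_of r + 1))
           \<le> real k + 3 * (1 + \<epsilon> r) * real r * ln (real r) / ln (ln (real r))))"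
proof (rule conjI[OF _ t_of_error_term], intro allI impI)
  fix r k :: nat and G :: "'a ugraph"
  assume "r \<ge> 2 \<and> k \<ge> 1 \<and> simple_graph G \<and> partite r G \<and> mad G \<le> 2 * real k"
  then show "proper_orientation_number G \<le> k + 3 * r * (t_of r + 1)"
    using t_of_props[of r] by (intro proper_orientation_bound) auto
qed

end
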